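(* Let $\{X_t: t\ge 0\}$ be an irreducible continuous-time Markov process on a countable state space $E$ with generator $L$, admitting a stationary measure $\mu$; let $L^*$ be the adjoint generator and $S=\frac12(L+L^* )$. Let $A,B$ be disjoint subsets of $E$ such that $B^c=E\setminus B$ is finite. Then $$\mathrm{cap}(A,B)\;=\;\inf_F\,\sup_H\Big\{2\langle L^*F,H\rangle_\mu-\langle H,(-S)H\rangle_\mu\Big\},$$ where the supremum is over all functions $H:E\to\mathbb R$ which are constant on $A$ and constant on $B$, and the infimum is over all functions $F:E\to\mathbb R$ which are equal to $1$ on $A$ and to $0$ on $B$. Moreover, the function $F_{A,B}$ which solves this variational problem for the capacity (i.e. attains the infimum) is $$F_{A,B}=\tfrac12\{V_{A,B}+V^*_{A,B}\}.$$
   Context: $X_t$ has holding rates $\lambda(x)$, jump probabilities $p(x,y)$ ($x\ne y$) and jump rates $r(x,y)=\lambda(x)p(x,y)$; its law started at $x$ on the space $D(\mathbb R_+,E)$ of right-continuous paths with left limits is $\mathbb P_x$. The stationary measure $\mu$ (not necessarily finite, $\mu(x)>0$) satisfies $\sum_{y}\mu(y)r(y,x)=\mu(x)\lambda(x)$ for all $x$. For bounded $f$, $(Lf)(x)=\sum_y r(x,y)[f(y)-f(x)]$. The adjoint (time-reversed) process $X^*_t$, with law $\mathbb P^*_x$ and generator $L^*$, has holding rates $\lambda(x)$ and jump rates $r^*(x,y)$ determined by $\mu(x)r(x,y)=\mu(y)r^*(y,x)$; $L^*$ acts on bounded functions by the same formula with $r^*$ in place of $r$. $\langle f,g\rangle_\mu=\sum_{x}\mu(x)f(x)g(x)$.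 Set $M(x)=\mu(x)\lambda(x)$. Hitting and return times: $T_A=\inf\{s>0:X_s\in A\}$, $T_A^+=\inf\{t>0: X_t\in A,\ X_s\ne X_0\text{ for some }0<s<t\}$. Capacity: for disjoint $A,B\subset E$, $\mathrm{cap}(A,B)=\sum_{x\in A}M(x)\,\mathbb P_x[T_A^+>T_B^+]$. Equilibrium potentials: $V_{A,B}(x)=\mathbb P_x[T_A<T_B]$, $V^*_{A,B}(x)=\mathbb P^*_x[T_A<T_B]$. Since $B^c$ is finite, the functions $F$ and $H$ in the formula are bounded and all the series $\langle\cdot,\cdot\rangle_\mu$ in it converge absolutely. *)

theory Defs
  imports "HOL-Probability.Probability"
begin

text \<open>
  The state space \<open>E\<close> is the type \<open>'a :: countable\<close>, with the discrete topology.
\<close>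

section \<open>Rates\<close>

text \<open>
  \<open>p x y\<close> is a jump probability only for \<open>x \<noteq> y\<close>; we put \<open>p x x = 0\<close>. A holding rate \<open>0\<close>
  means that the process stays at \<open>x\<close> forever, and then \<open>p x = 0\<close> by convention. For an irreducible
  chain this happens only if \<open>E\<close> is a single point.
\<close>

definition jump_parameters :: "('a \<Rightarrow> real) \<Rightarrow> ('a \<Rightarrow> 'a \<Rightarrow> real) \<Rightarrow> bool" where
  "jump_parameters lam p \<longleftrightarrow>
     (\<forall>x. 0 \<le> lam x) \<and> (\<forall>x y. 0 \<le> p x y) \<and> (\<forall>x. p x x = 0) \<and>
     (\<forall>x. (p x has_sum (if lam x = 0 then 0 else 1)) UNIV)"

definition jump_rate :: "('a \<Rightarrow> real) \<Rightarrow> ('a \<Rightarrow> 'a \<Rightarrow> real) \<Rightarrow> 'a \<Rightarrow> 'a \<Rightarrow> real" where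
  "jump_rate lam p x y = lam x * p x y"

definition irreducible_rates :: "('a \<Rightarrow> 'a \<Rightarrow> real) \<Rightarrow> bool" where
  "irreducible_rates r \<longleftrightarrow> (\<forall>x y. (x, y) \<in> {(u, v). 0 < r u v}\<^sup>*)"

definition stationary_measure ::
    "('a \<Rightarrow> real) \<Rightarrow> ('a \<Rightarrow> 'a \<Rightarrow> real) \<Rightarrow> ('a \<Rightarrow> real) \<Rightarrow> bool" where
  "stationary_measure lam r mu \<longleftrightarrow>
     (\<forall>x. 0 < mu x) \<and> (\<forall>x. ((\<lambda>y. mu y * r y x) has_sum (mu x * lam x)) UNIV)"

text \<open>The solution \<open>r\<^sup>*\<close> of \<open>\<mu>(y) r(y,x) = \<mu>(x) r\<^sup>*(x,y)\<close>.\<close>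

definition adjoint_rate :: "('a \<Rightarrow> real) \<Rightarrow> ('a \<Rightarrow> 'a \<Rightarrow> real) \<Rightarrow> 'a \<Rightarrow> 'a \<Rightarrow> real" where
  "adjoint_rate mu r x y = mu y * r y x / mu x"

text \<open>The jump probabilities of the adjoint process, whose holding rates are again \<open>lam\<close>.\<close>

definition adjoint_prob ::
    "('a \<Rightarrow> real) \<Rightarrow> ('a \<Rightarrow> real) \<Rightarrow> ('a \<Rightarrow> 'a \<Rightarrow> real) \<Rightarrow> 'a \<Rightarrow> 'a \<Rightarrow> real" where
  "adjoint_prob lam mu p x y = adjoint_rate mu (jump_rate lam p) x y / lam x"

section \<open>The process\<close>

text \<open>
  \<open>D(\<real>\<^sub>+, E)\<close> for discrete \<open>E\<close>, with the \<open>\<sigma>\<close>-algebra generated by the coordinates. Paths are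
  functions on \<open>real\<close> that are \<open>undefined\<close> at negative times.
\<close>

definition cadlag_paths :: "(real \<Rightarrow> 'a) set" where
  "cadlag_paths =
     {\<omega>. (\<forall>t\<ge>0. \<forall>\<^sub>F s in at_right t. \<omega> s = \<omega> t) \<and>
         (\<forall>t>0. \<exists>x. \<forall>\<^sub>F s in at_left t. \<omega> s = x)}"

definition path_space :: "(real \<Rightarrow> 'a) measure" where
  "path_space = restrict_space (\<Pi>\<^sub>M t\<in>{0..}. count_space UNIV) cadlag_paths"

text \<open>
  The \<open>n\<close>-th jump time, \<open>\<infinity>\<close> if there are fewer than \<open>n\<close> jumps. A path in \<^term>\<open>cadlag_paths\<close>
  has finitely many jumps in bounded time, so the jump times describe the whole path.
\<close>

primrec jump_time :: "(real \<Rightarrow> 'a) \<Rightarrow> nat \<Rightarrow> ereal" where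
  "jump_time \<omega> 0 = 0"
| "jump_time \<omega> (Suc n) =
     Inf {ereal t |t. jump_time \<omega> n < ereal t \<and> \<omega> t \<noteq> \<omega> (real_of_ereal (jump_time \<omega> n))}"

definition jump_chain :: "(real \<Rightarrow> 'a) \<Rightarrow> nat \<Rightarrow> 'a" where
  "jump_chain \<omega> n = \<omega> (real_of_ereal (jump_time \<omega> n))"

definition holding_time :: "(real \<Rightarrow> 'a) \<Rightarrow> nat \<Rightarrow> ereal" where
  "holding_time \<omega> n = jump_time \<omega> (Suc n) - jump_time \<omega> n"

text \<open>
  \<open>P x\<close> is the law on \<open>D(\<real>\<^sub>+, E)\<close> of the Markov process with holding rates \<open>lam\<close> and jump
  probabilities \<open>p\<close> started at \<open>x\<close>: the jump chain is the discrete-time Markov chain with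
  transition probabilities \<open>p\<close> started at \<open>x\<close> and, given the jump chain, the holding times are
  independent and exponential with the rates \<open>lam\<close> of the states visited. The events below
  generate the \<open>\<sigma>\<close>-algebra, so \<open>P\<close> is determined by \<open>lam\<close> and \<open>p\<close>; it exists exactly when the
  process does not explode. At an absorbing state the formula gives probability \<open>0\<close> to a further
  jump, since then \<open>p = 0\<close>.
\<close>

definition markov_law ::
    "('a \<Rightarrow> real) \<Rightarrow> ('a \<Rightarrow> 'a \<Rightarrow> real) \<Rightarrow> ('a \<Rightarrow> (real \<Rightarrow> 'a) measure) \<Rightarrow> bool" where
  "markov_law lam p P \<longleftrightarrow>
     (\<forall>x. prob_space (P x) \<and> sets (P x) = sets path_space) \<and>
     (\<forall>x n (y :: nat \<Rightarrow> 'a) (s :: nat \<Rightarrow> real). (\<forall>i<n. 0 \<le> s i) \<longrightarrow>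
        measure (P x) {\<omega> \<in> space (P x). jump_time \<omega> n < \<infinity> \<and>
            (\<forall>i\<le>n. jump_chain \<omega> i = y i) \<and> (\<forall>i<n. ereal (s i) < holding_time \<omega> i)} =
        (if y 0 = x then \<Prod>i<n. exp (- lam (y i) * s i) * p (y i) (y (Suc i)) else 0))"

definition hitting_time :: "'a set \<Rightarrow> (real \<Rightarrow> 'a) \<Rightarrow> ereal" where
  "hitting_time A \<omega> = Inf {ereal s |s. 0 < s \<and> \<omega> s \<in> A}"

definition return_time :: "'a set \<Rightarrow> (real \<Rightarrow> 'a) \<Rightarrow> ereal" where
  "return_time A \<omega> =
     Inf {ereal t |t. 0 < t \<and> \<omega> t \<in> A \<and> (\<exists>s. 0 < s \<and> s < t \<and> \<omega> s \<noteq> \<omega> 0)}"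

section \<open>Capacity and equilibrium potential\<close>

definition capacity ::
    "('a \<Rightarrow> real) \<Rightarrow> ('a \<Rightarrow> real) \<Rightarrow> ('a \<Rightarrow> (real \<Rightarrow> 'a) measure) \<Rightarrow> 'a set \<Rightarrow> 'a set \<Rightarrow> real" where
  "capacity lam mu P A B =
     (\<Sum>\<^sub>\<infinity>x\<in>A. mu x * lam x *
        measure (P x) {\<omega> \<in> space (P x). return_time B \<omega> < return_time A \<omega>})"

definition equilibrium_potential ::
    "('a \<Rightarrow> (real \<Rightarrow> 'a) measure) \<Rightarrow> 'a set \<Rightarrow> 'a set \<Rightarrow> 'a \<Rightarrow> real" where
  "equilibrium_potential P A B x =
     measure (P x) {\<omega> \<in> space (P x). hitting_time A \<omega> < hitting_time B \<omega>}"

section \<open>Generators and the variational functional\<close>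

text \<open>
  \<^const>\<open>infsum\<close> is \<open>0\<close> for families that are not summable. For bounded \<open>f\<close> the series in
  \<open>generator\<close> converges absolutely.
\<close>

definition generator :: "('a \<Rightarrow> 'a \<Rightarrow> real) \<Rightarrow> ('a \<Rightarrow> real) \<Rightarrow> 'a \<Rightarrow> real" where
  "generator r f x = (\<Sum>\<^sub>\<infinity>y. r x y * (f y - f x))"

definition symmetric_generator ::
    "('a \<Rightarrow> real) \<Rightarrow> ('a \<Rightarrow> 'a \<Rightarrow> real) \<Rightarrow> ('a \<Rightarrow> real) \<Rightarrow> 'a \<Rightarrow> real" where
  "symmetric_generator mu r f x = (generator r f x + generator (adjoint_rate mu r) f x) / 2"

definition inner_mu :: "('a \<Rightarrow> real) \<Rightarrow> ('a \<Rightarrow> real) \<Rightarrow> ('a \<Rightarrow> real) \<Rightarrow> real" where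
  "inner_mu mu f g = (\<Sum>\<^sub>\<infinity>x. mu x * f x * g x)"

definition saddle_functional ::
    "('a \<Rightarrow> real) \<Rightarrow> ('a \<Rightarrow> 'a \<Rightarrow> real) \<Rightarrow> ('a \<Rightarrow> real) \<Rightarrow> ('a \<Rightarrow> real) \<Rightarrow> real" where
  "saddle_functional mu r F H =
     2 * inner_mu mu (generator (adjoint_rate mu r) F) H
       - inner_mu mu H (\<lambda>x. - symmetric_generator mu r H x)"

definition boundary_functions :: "'a set \<Rightarrow> 'a set \<Rightarrow> ('a \<Rightarrow> real) set" where
  "boundary_functions A B = {F. (\<forall>x\<in>A. F x = 1) \<and> (\<forall>x\<in>B. F x = 0)}"

definition test_functions :: "'a set \<Rightarrow> 'a set \<Rightarrow> ('a \<Rightarrow> real) set" where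
  "test_functions A B = {H. H constant_on A \<and> H constant_on B}"

text \<open>Valued in \<^typ>\<open>ereal\<close>, so that the supremum over an unbounded set is \<open>\<infinity>\<close>.\<close>

definition sup_functional ::
    "('a \<Rightarrow> real) \<Rightarrow> ('a \<Rightarrow> 'a \<Rightarrow> real) \<Rightarrow> 'a set \<Rightarrow> 'a set \<Rightarrow> ('a \<Rightarrow> real) \<Rightarrow> ereal" where
  "sup_functional mu r A B F = (SUP H\<in>test_functions A B. ereal (saddle_functional mu r F H))"

end

theory Submission
  imports Defs
begin

text \<open>
  Write \<open>D(f,g) = \<langle>-Lf,g\<rangle>\<close>. Functions vanishing on \<open>B\<close> live on the finite set \<open>K = - B\<close>, and subtracting
  from \<open>H\<close> its value on \<open>B\<close> does not change the functional, which becomes \<open>-2 D(H,F) - D(H,H)\<close>.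
  As \<open>V\<close> is \<open>L\<close>-harmonic and \<open>V*\<close> is \<open>L*\<close>-harmonic off \<open>A \<union> B\<close>, one has
  \<open>D(V,g) = a cap = D(g,V*)\<close> whenever \<open>g = a\<close> on \<open>A\<close>. The choice \<open>H = -V\<close> thus gives at least \<open>cap\<close> for
  every \<open>F\<close>, while for \<open>F = (V + V*)/2\<close> the functional is \<open>cap - D(H+V,H+V)\<close>. If \<open>F + G\<close> is another
  minimiser, \<open>H = -G-V\<close> yields \<open>D(G,G) \<le> 0\<close>, and irreducibility forces \<open>G = 0\<close>.

  The harmonicity of \<open>V\<close> needs only lower bounds: cylinder events of the jump chain bound the
  probabilities of entering \<open>A\<close> before \<open>B\<close> and \<open>B\<close> before \<open>A\<close> from below, and these bounds add up to \<open>1\<close>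
  in the limit, so they are sharp.
\<close>

section \<open>Entrance times\<close>

text \<open>One notion for both times of the statement: \<open>k = 0\<close> gives the hitting time,
  and \<open>k = 1\<close> the return time, because the first jump time lies below \<open>t\<close>
  exactly when the path has left its starting value before \<open>t\<close>.\<close>

definition entrance_time :: "nat \<Rightarrow> 'a set \<Rightarrow> (real \<Rightarrow> 'a) \<Rightarrow> ereal" where
  "entrance_time k A \<omega> = Inf {ereal t |t. jump_time \<omega> k < ereal t \<and> \<omega> t \<in> A}"

lemma hitting_time_eq_entrance: "hitting_time A = entrance_time 0 A"
  by (simp add: fun_eq_iff hitting_time_def entrance_time_def)

lemma jump_time_1_less_iff:
  "jump_time \<omega> 1 < ereal t \<longleftrightarrow> (\<exists>s. 0 < s \<and> s < t \<and> \<omega> s \<noteq> \<omega> 0)"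
  by (auto simp: Inf_less_iff)

lemma jump_time_nonneg: "0 \<le> jump_time \<omega> n"
proof (induction n)
  case (Suc n)
  then show ?case by (auto intro!: Inf_greatest dest: le_less_trans)
qed simp

lemma jump_time_mono: "m \<le> n \<Longrightarrow> jump_time \<omega> m \<le> jump_time \<omega> n"
  by (rule lift_Suc_mono_le[of "jump_time \<omega>"]) (auto intro!: Inf_greatest)

lemma return_time_eq_entrance: "return_time A = entrance_time 1 A"
proof
  fix \<omega> :: "real \<Rightarrow> 'a"
  have "0 < t" if "jump_time \<omega> 1 < ereal t" for t
    using le_less_trans[OF jump_time_nonneg that] by simp
  then show "return_time A \<omega> = entrance_time 1 A \<omega>"
    unfolding return_time_def entrance_time_def jump_time_1_less_iff[symmetric]
    by (intro arg_cong[where f = Inf]) blast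
qed

section \<open>Path properties: comparing entrance times along right-continuous paths\<close>

lemma cadlag_right_constant:
  assumes "\<omega> \<in> cadlag_paths" "0 \<le> t"
  obtains e where "0 < e" "\<And>s. t \<le> s \<Longrightarrow> s < t + e \<Longrightarrow> \<omega> s = \<omega> t"
proof -
  have "\<forall>\<^sub>F s in at_right t. \<omega> s = \<omega> t"
    using assms by (simp add: cadlag_paths_def)
  then obtain b where "t < b" "\<And>s. t < s \<Longrightarrow> s < b \<Longrightarrow> \<omega> s = \<omega> t"
    by (auto simp: eventually_at_right_field)
  then show thesis
    using that[of "b - t"] by (auto simp: order_le_less)
qed

text \<open>A value other than \<open>jump_chain \<omega> i\<close>, taken after
  \<open>jump_time \<omega> i\<close>, would belong to the set whose infimum is the next jump
  time.\<close>

lemma cadlag_before_jump: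
  assumes "0 \<le> s" "ereal s < jump_time \<omega> n"
  obtains i where "i < n" "jump_time \<omega> i \<le> ereal s" "ereal s < jump_time \<omega> (Suc i)"
    "\<omega> s = jump_chain \<omega> i"
  using assms(2)
proof (induction n arbitrary: thesis)
  case 0
  then show ?case using assms(1) by simp
next
  case (Suc n)
  show ?case
  proof (cases "ereal s < jump_time \<omega> n")
    case True
    then show ?thesis using Suc.IH Suc.prems(1) less_SucI by metis
  next
    case False
    then have le: "jump_time \<omega> n \<le> ereal s" by simp
    have "\<omega> s = jump_chain \<omega> n"
    proof (rule ccontr)
      assume ne: "\<omega> s \<noteq> jump_chain \<omega> n"
      then have "jump_time \<omega> n \<noteq> ereal s" by (auto simp: jump_chain_def)
      with le have "jump_time \<omega> n < ereal s" by simp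
      with ne have "jump_time \<omega> (Suc n) \<le> ereal s"
        by (auto intro!: Inf_lower simp: jump_chain_def)
      then show False using Suc.prems(2) by simp
    qed
    then show ?thesis using le Suc.prems by blast
  qed
qed

text \<open>To the right of each of its points \<open>U\<close> contains an interval, hence a
  rational, and likewise \<open>W\<close>; so rationals decide the comparison. This turns an order
  of infima into countably many coordinate conditions.\<close>

lemma Inf_less_Inf_iff_rat:
  fixes U W :: "real \<Rightarrow> bool"
  assumes U: "\<And>t. U t \<Longrightarrow> \<exists>e>0. \<forall>s. t \<le> s \<and> s < t + e \<longrightarrow> U s"
    and W: "\<And>t. W t \<Longrightarrow> \<exists>e>0. \<forall>s. t \<le> s \<and> s < t + e \<longrightarrow> W s"
    and UW: "\<And>t. \<not> (U t \<and> W t)"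
  shows "Inf {ereal t |t. U t} < Inf {ereal t |t. W t} \<longleftrightarrow>
    (\<exists>q::rat. U (of_rat q) \<and> (\<forall>s::rat. s \<le> q \<longrightarrow> \<not> W (of_rat s)))"
proof
  assume "Inf {ereal t |t. U t} < Inf {ereal t |t. W t}"
  then obtain t where t: "U t" "ereal t < Inf {ereal t |t. W t}"
    by (auto simp: Inf_less_iff)
  then obtain t' where t': "t < t'" "ereal t' < Inf {ereal t |t. W t}"
    using ereal_dense2[OF t(2)] by auto
  obtain e where e: "e > 0" "\<And>s. t \<le> s \<Longrightarrow> s < t + e \<Longrightarrow> U s"
    using U[OF t(1)] by blast
  obtain q :: rat where q: "t < of_rat q" "of_rat q < min t' (t + e)"
    using of_rat_dense[of t "min t' (t + e)"] t'(1) e(1) by auto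
  have "\<not> W (of_rat s)" if "s \<le> q" for s
  proof
    assume "W (of_rat s)"
    then have "Inf {ereal t |t. W t} \<le> ereal (of_rat s)"
      by (auto intro!: Inf_lower)
    moreover have "(of_rat s :: real) \<le> of_rat q"
      using that by (simp add: of_rat_less_eq)
    ultimately show False
      using t'(2) q(2) less_le_trans[OF t'(2), of "ereal (of_rat s)"] by simp
  qed
  then show "\<exists>q::rat. U (of_rat q) \<and> (\<forall>s::rat. s \<le> q \<longrightarrow> \<not> W (of_rat s))"
    using e(2)[of "of_rat q"] q by auto
next
  assume "\<exists>q::rat. U (of_rat q) \<and> (\<forall>s::rat. s \<le> q \<longrightarrow> \<not> W (of_rat s))"
  then obtain q :: rat where q: "U (of_rat q)" "\<And>s. s \<le> q \<Longrightarrow> \<not> W (of_rat s)"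
    by blast
  obtain e where e: "e > 0" "\<And>s. of_rat q \<le> s \<Longrightarrow> s < of_rat q + e \<Longrightarrow> U s"
    using U[OF q(1)] by blast
  \<comment> \<open>A point in \<open>[q, q + e)\<close> belongs to \<open>U\<close>, hence not to
    \<open>W\<close>; a point of \<open>W\<close> left of \<open>q\<close> would bring along a
    rational of \<open>W\<close> left of \<open>q\<close>. The gap \<open>e\<close> makes the
    comparison strict.\<close>
  have "of_rat q + e \<le> t" if Wt: "W t" for t
  proof (rule ccontr)
    assume less: "\<not> of_rat q + e \<le> t"
    have "t < of_rat q"
      using e(2)[of t] UW[of t] Wt less by fastforce
    obtain d where d: "d > 0" "\<And>s. t \<le> s \<Longrightarrow> s < t + d \<Longrightarrow> W s"
      using W[OF Wt] by blast
    obtain s :: rat where "t < of_rat s" "of_rat s < min (t + d) (of_rat q)"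
      using of_rat_dense[of t "min (t + d) (of_rat q)"] d(1) \<open>t < of_rat q\<close> by auto
    then show False
      using d(2)[of "of_rat s"] q(2)[of s] by (simp add: of_rat_less)
  qed
  then have "ereal (of_rat q + e) \<le> Inf {ereal t |t. W t}"
    by (auto intro!: Inf_greatest)
  moreover have "Inf {ereal t |t. U t} \<le> ereal (of_rat q)"
    using q(1) by (auto intro!: Inf_lower)
  moreover have "ereal (of_rat q) < ereal (of_rat q + e)"
    using e(1) by simp
  ultimately show "Inf {ereal t |t. U t} < Inf {ereal t |t. W t}"
    by (meson le_less_trans less_le_trans)
qed

lemma entrance_set_right_open:
  assumes "\<omega> \<in> cadlag_paths" "jump_time \<omega> k < ereal t \<and> \<omega> t \<in> A"
  shows "\<exists>e>0. \<forall>s. t \<le> s \<and> s < t + e \<longrightarrow> jump_time \<omega> k < ereal s \<and> \<omega> s \<in> A"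
proof -
  have "0 < t" using le_less_trans[OF jump_time_nonneg conjunct1[OF assms(2)]] by simp
  then obtain e where e: "0 < e" "\<And>s. t \<le> s \<Longrightarrow> s < t + e \<Longrightarrow> \<omega> s = \<omega> t"
    using cadlag_right_constant[OF assms(1)] by (metis less_imp_le)
  have "jump_time \<omega> k < ereal s \<and> \<omega> s \<in> A" if "t \<le> s \<and> s < t + e" for s
    using e(2)[of s] assms(2) that less_le_trans[of "jump_time \<omega> k" "ereal t" "ereal s"] by auto
  with e(1) show ?thesis by blast
qed

lemma entrance_time_less_iff:
  assumes "\<omega> \<in> cadlag_paths" "A \<inter> B = {}"
  shows "entrance_time k A \<omega> < entrance_time k B \<omega> \<longleftrightarrow>
    (\<exists>q::rat. (jump_time \<omega> k < ereal (of_rat q) \<and> \<omega> (of_rat q) \<in> A) \<and>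
       (\<forall>s::rat. s \<le> q \<longrightarrow> \<not> (jump_time \<omega> k < ereal (of_rat s) \<and> \<omega> (of_rat s) \<in> B)))"
  unfolding entrance_time_def
  by (rule Inf_less_Inf_iff_rat) (use assms entrance_set_right_open in blast)+

text \<open>The events of \<open>markov_law\<close> with all \<open>s i = 0\<close>: the exponential
  factors become 1 and the probability is the weight of a path of the jump chain.\<close>

definition jump_cylinder :: "(real \<Rightarrow> 'a) measure \<Rightarrow> nat \<Rightarrow> (nat \<Rightarrow> 'a) \<Rightarrow> (real \<Rightarrow> 'a) set" where
  "jump_cylinder M n y = {\<omega> \<in> space M. jump_time \<omega> n < \<infinity> \<and>
     (\<forall>i\<le>n. jump_chain \<omega> i = y i) \<and> (\<forall>i<n. ereal 0 < holding_time \<omega> i)}"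

text \<open>Between the jump times \<open>k\<close> and \<open>m\<close> the path only takes values
  \<open>y i\<close> outside \<open>B\<close>, and after jump time \<open>m\<close> it stays in
  \<open>A\<close> for a positive time.\<close>

lemma entrance_time_less_on_cylinder:
  assumes \<omega>: "\<omega> \<in> cadlag_paths" "\<omega> \<in> jump_cylinder M m y"
    and "k \<le> m" "\<And>i. k \<le> i \<Longrightarrow> i \<le> m \<Longrightarrow> y i \<notin> B" "y m \<in> A"
  shows "entrance_time k A \<omega> < entrance_time k B \<omega>"
proof -
  have chain: "\<And>i. i \<le> m \<Longrightarrow> jump_chain \<omega> i = y i" and fin: "jump_time \<omega> m < \<infinity>"
    using \<omega>(2) by (auto simp: jump_cylinder_def)
  obtain j where j: "jump_time \<omega> m = ereal j" "0 \<le> j"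
    using fin jump_time_nonneg[of \<omega> m] by (cases "jump_time \<omega> m") auto
  have wj: "\<omega> j = y m" using chain[of m] j by (simp add: jump_chain_def)
  \<comment> \<open>If \<open>m = k\<close>, the time \<open>j\<close> itself does not count, since
    entrance is strictly after \<open>jump_time \<omega> k\<close>. So \<open>j + e / 2\<close> is
    the witness for \<open>A\<close>, while \<open>B\<close> is avoided up to
    \<open>j + e\<close>.\<close>
  obtain e where e: "0 < e" "\<And>s. j \<le> s \<Longrightarrow> s < j + e \<Longrightarrow> \<omega> s = \<omega> j"
    using cadlag_right_constant[OF \<omega>(1) j(2)] by metis
  have "jump_time \<omega> k \<le> ereal j"
    using jump_time_mono[OF \<open>k \<le> m\<close>] j by metis
  also have "ereal j < ereal (j + e / 2)" using e(1) by simp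
  finally have "jump_time \<omega> k < ereal (j + e / 2) \<and> \<omega> (j + e / 2) \<in> A"
    using e(2)[of "j + e / 2"] e(1) wj assms(5) by simp
  then have 1: "entrance_time k A \<omega> \<le> ereal (j + e / 2)"
    unfolding entrance_time_def by (intro Inf_lower) blast
  have "j + e \<le> t" if t: "jump_time \<omega> k < ereal t" "\<omega> t \<in> B" for t
  proof (rule ccontr)
    assume less: "\<not> j + e \<le> t"
    have "0 \<le> t" using le_less_trans[OF jump_time_nonneg t(1)] by simp
    have "t < j"
      using e(2)[of t] wj t(2) assms(3) assms(4)[of m] less by force
    then have "ereal t < jump_time \<omega> m" using j by simp
    then obtain i where i: "i < m" "jump_time \<omega> i \<le> ereal t" "ereal t < jump_time \<omega> (Suc i)"
      "\<omega> t = jump_chain \<omega> i"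
      using cadlag_before_jump[OF \<open>0 \<le> t\<close>] by metis
    have "k < Suc i"
      using jump_time_mono[of "Suc i" k \<omega>] t(1) i(3) by (meson not_le_imp_less order_less_le_trans order_less_asym)
    then show False using assms(4)[of i] i t(2) chain[of i] by simp
  qed
  then have "ereal (j + e) \<le> entrance_time k B \<omega>"
    unfolding entrance_time_def by (intro Inf_greatest) auto
  moreover have "ereal (j + e / 2) < ereal (j + e)" using e(1) by simp
  ultimately show ?thesis using 1 by (meson le_less_trans less_le_trans)
qed

section \<open>Measurability of the events that compare entrance times\<close>

lemma path_space_component:
  assumes "sets M = sets path_space" "0 \<le> t"
  shows "(\<lambda>\<omega>. \<omega> t) \<in> measurable M (count_space UNIV)"
proof -
  have "(\<lambda>\<omega>. \<omega> t) \<in> measurable path_space (count_space (UNIV :: 'a set))"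
    unfolding path_space_def
    by (rule measurable_restrict_space1) (use assms(2) in \<open>auto intro: measurable_component_singleton\<close>)
  then show ?thesis using measurable_cong_sets[OF assms(1)] by blast
qed

lemma space_subset_cadlag:
  assumes "sets M = sets path_space"
  shows "space M \<subseteq> cadlag_paths"
  using sets_eq_imp_space_eq[OF assms] by (auto simp: path_space_def space_restrict_space)

lemma sets_coordinate:
  assumes "sets M = sets path_space" "0 \<le> t"
  shows "{\<omega> \<in> space M. \<omega> t \<in> A} \<in> sets M"
  using measurable_sets[OF path_space_component[OF assms], of A]
  by (simp add: vimage_def Int_def conj_commute)

text \<open>A departure from \<open>\<omega> 0\<close> persists for a while and so shows at a
  rational time; countability of the state space splits
  \<open>\<omega> s \<noteq> \<omega> 0\<close> into coordinate events.\<close>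

lemma sets_jump_time_1_less:
  fixes M :: "(real \<Rightarrow> 'a :: countable) measure"
  assumes "sets M = sets path_space"
  shows "{\<omega> \<in> space M. jump_time \<omega> 1 < ereal t} \<in> sets M"
proof -
  have "(\<exists>s. 0 < s \<and> s < t \<and> \<omega> s \<noteq> \<omega> 0) \<longleftrightarrow>
      (\<exists>s::rat. 0 < s \<and> (of_rat s :: real) < t \<and> \<omega> (of_rat s) \<noteq> \<omega> 0)"
    if "\<omega> \<in> space M" for \<omega>
  proof
    assume "\<exists>s. 0 < s \<and> s < t \<and> \<omega> s \<noteq> \<omega> 0"
    then obtain s where s: "0 < s" "s < t" "\<omega> s \<noteq> \<omega> 0" by blast
    have "\<omega> \<in> cadlag_paths" using that space_subset_cadlag[OF assms] by blast
    then obtain e where e: "0 < e" "\<And>u. s \<le> u \<Longrightarrow> u < s + e \<Longrightarrow> \<omega> u = \<omega> s"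
      using cadlag_right_constant[of \<omega> s] s(1) by (metis less_imp_le)
    obtain q :: rat where "s < of_rat q" "of_rat q < min t (s + e)"
      using of_rat_dense[of s "min t (s + e)"] s e(1) by auto
    moreover from this have "(0::real) < of_rat q" using s(1) by linarith
    ultimately show "\<exists>s::rat. 0 < s \<and> (of_rat s :: real) < t \<and> \<omega> (of_rat s) \<noteq> \<omega> 0"
      using e(2)[of "of_rat q"] s(3) by (intro exI[of _ q]) (auto simp: zero_less_of_rat_iff)
  next
    assume "\<exists>s::rat. 0 < s \<and> (of_rat s :: real) < t \<and> \<omega> (of_rat s) \<noteq> \<omega> 0"
    then show "\<exists>s. 0 < s \<and> s < t \<and> \<omega> s \<noteq> \<omega> 0"
      by (metis zero_less_of_rat_iff)
  qed
  then have "{\<omega> \<in> space M. jump_time \<omega> 1 < ereal t} =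
      {\<omega> \<in> space M. \<exists>s::rat. 0 < s \<and> (of_rat s :: real) < t \<and> \<omega> (of_rat s) \<noteq> \<omega> 0}"
    unfolding jump_time_1_less_iff by blast
  also have "\<dots> = (\<Union>s\<in>{s::rat. 0 < s \<and> (of_rat s :: real) < t}. \<Union>z::'a.
      {\<omega> \<in> space M. \<omega> (of_rat s) \<in> - {z}} \<inter> {\<omega> \<in> space M. \<omega> 0 \<in> {z}})"
    by auto
  also have "\<dots> \<in> sets M"
    by (intro sets.countable_UN'' sets.Int sets_coordinate[OF assms]) auto
  finally show ?thesis .
qed

lemma sets_entrance_time_less:
  fixes M :: "(real \<Rightarrow> 'a :: countable) measure"
  assumes "sets M = sets path_space" "A \<inter> B = {}" "k \<le> 1"
  shows "{\<omega> \<in> space M. entrance_time k A \<omega> < entrance_time k B \<omega>} \<in> sets M"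
proof -
  have J: "{\<omega> \<in> space M. jump_time \<omega> k < ereal t} \<in> sets M" for t
  proof (cases "k = 0")
    case True
    then show ?thesis by simp
  next
    case False
    then have "k = 1" using assms(3) by simp
    then show ?thesis using sets_jump_time_1_less[OF assms(1)] by simp
  qed
  have C: "{\<omega> \<in> space M. jump_time \<omega> k < ereal t \<and> \<omega> t \<in> C} \<in> sets M" for t C
  proof (cases "0 \<le> t")
    case True
    then show ?thesis using J sets_coordinate[OF assms(1)] by (intro sets.sets_Collect) auto
  next
    \<comment> \<open>The rational quantifiers also run over negative times, where a path has no
      coordinate; there the event is empty because jump times are nonnegative.\<close>
    case False
    then have "\<not> jump_time \<omega> k < ereal t" for \<omega> :: "real \<Rightarrow> 'a"
      using le_less_trans[OF jump_time_nonneg, of \<omega> k "ereal t"] by auto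
    then show ?thesis by simp
  qed
  have "{\<omega> \<in> space M. entrance_time k A \<omega> < entrance_time k B \<omega>} =
    {\<omega> \<in> space M. \<exists>q::rat. (jump_time \<omega> k < ereal (of_rat q) \<and> \<omega> (of_rat q) \<in> A) \<and>
       (\<forall>s::rat. s \<le> q \<longrightarrow> \<not> (jump_time \<omega> k < ereal (of_rat s) \<and> \<omega> (of_rat s) \<in> B))}"
    using entrance_time_less_iff[OF _ assms(2)] space_subset_cadlag[OF assms(1)] by blast
  also have "\<dots> \<in> sets M"
    by (intro sets.sets_Collect_countable_Ex sets.sets_Collect_countable_All
        sets.sets_Collect_conj sets.sets_Collect_imp sets.sets_Collect_neg sets.sets_Collect_const C)
  finally show ?thesis .
qed

section \<open>Entrance probabilities and the jump chain\<close>

lemma has_sum_minus: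
  fixes f g :: "'a \<Rightarrow> real"
  assumes "(f has_sum a) X" "(g has_sum b) X"
  shows "((\<lambda>x. f x - g x) has_sum (a - b)) X"
  using has_sum_add[OF assms(1) has_sum_uminusI[OF assms(2)]] by simp

text \<open>For disjoint \<open>A\<close> and \<open>B\<close>: the probability that the discrete
  chain reaches \<open>A\<close> within \<open>n\<close> steps and before \<open>B\<close>, time 0
  included.\<close>

primrec hit_prob :: "('a \<Rightarrow> 'a \<Rightarrow> real) \<Rightarrow> 'a set \<Rightarrow> 'a set \<Rightarrow> nat \<Rightarrow> 'a \<Rightarrow> real" where
  "hit_prob p A B 0 x = (if x \<in> A then 1 else 0)"
| "hit_prob p A B (Suc n) x =
     (if x \<in> A then 1 else if x \<in> B then 0 else \<Sum>\<^sub>\<infinity>y. p x y * hit_prob p A B n y)"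

lemma jump_parametersD:
  assumes "jump_parameters lam p"
  shows "0 \<le> lam x" "0 \<le> p x y" "p x x = 0"
    "(p x has_sum (if lam x = 0 then 0 else 1)) UNIV" "lam x \<noteq> 0 \<Longrightarrow> (p x has_sum 1) UNIV"
proof -
  show *: "0 \<le> lam x" "0 \<le> p x y" "p x x = 0"
    "(p x has_sum (if lam x = 0 then 0 else 1)) UNIV"
    using assms unfolding jump_parameters_def by blast+
  show "(p x has_sum 1) UNIV" if "lam x \<noteq> 0" using *(4) that by simp
qed

lemma weighted_jump_sum:
  fixes h :: "'a \<Rightarrow> real"
  assumes "jump_parameters lam p" "\<And>y. 0 \<le> h y" "\<And>y. h y \<le> 1"
  shows "(\<lambda>y. p x y * h y) summable_on UNIV" "0 \<le> (\<Sum>\<^sub>\<infinity>y. p x y * h y)"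
    "(\<Sum>\<^sub>\<infinity>y. p x y * h y) \<le> 1"
proof -
  have p: "p x summable_on UNIV" "infsum (p x) UNIV \<le> 1"
    using jump_parametersD(4)[OF assms(1), of x]
    by (auto simp: has_sum_imp_summable infsumI split: if_splits)
  have le: "p x y * h y \<le> p x y" for y
    using jump_parametersD(2)[OF assms(1)] assms(2,3) by (simp add: mult_left_le)
  have nonneg: "0 \<le> p x y * h y" for y
    using jump_parametersD(2)[OF assms(1)] assms(2) by simp
  show *: "(\<lambda>y. p x y * h y) summable_on UNIV"
    by (rule summable_on_comparison_test[OF p(1)]) (use le nonneg in auto)
  show "0 \<le> (\<Sum>\<^sub>\<infinity>y. p x y * h y)"
    by (rule infsum_nonneg) (use nonneg in auto)
  have "(\<Sum>\<^sub>\<infinity>y. p x y * h y) \<le> infsum (p x) UNIV"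
    by (rule infsum_mono[OF * p(1)]) (use le in auto)
  then show "(\<Sum>\<^sub>\<infinity>y. p x y * h y) \<le> 1" using p(2) by simp
qed

lemma hit_prob_bounds:
  assumes "jump_parameters lam p"
  shows "0 \<le> hit_prob p A B n x \<and> hit_prob p A B n x \<le> 1"
proof (induction n arbitrary: x)
  case (Suc n)
  then show ?case using weighted_jump_sum(2,3)[OF assms, of "hit_prob p A B n" x] by simp
qed simp

section \<open>Lower bounds for entrance probabilities by cylinder events\<close>

lemma markov_lawD:
  assumes "markov_law lam p P"
  shows "prob_space (P x)" "sets (P x) = sets path_space"
  using assms by (auto simp: markov_law_def)

lemma measure_jump_cylinder:
  assumes "markov_law lam p P"
  shows "measure (P x) (jump_cylinder (P x) n y) =
    (if y 0 = x then \<Prod>i<n. p (y i) (y (Suc i)) else 0)"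
proof -
  have "\<forall>x n (y :: nat \<Rightarrow> 'a) (s :: nat \<Rightarrow> real). (\<forall>i<n. 0 \<le> s i) \<longrightarrow>
        measure (P x) {\<omega> \<in> space (P x). jump_time \<omega> n < \<infinity> \<and>
            (\<forall>i\<le>n. jump_chain \<omega> i = y i) \<and> (\<forall>i<n. ereal (s i) < holding_time \<omega> i)} =
        (if y 0 = x then \<Prod>i<n. exp (- lam (y i) * s i) * p (y i) (y (Suc i)) else 0)"
    using assms unfolding markov_law_def by blast
  from this[rule_format, of n "\<lambda>_. 0" x y] show ?thesis
    unfolding jump_cylinder_def by simp
qed

lemma jump_cylinder_Suc_subset:
  assumes "\<And>i. i \<le> n \<Longrightarrow> y' i = y i"
  shows "jump_cylinder M (Suc n) y' \<subseteq> jump_cylinder M n y"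
proof
  fix \<omega> assume \<omega>: "\<omega> \<in> jump_cylinder M (Suc n) y'"
  have "jump_time \<omega> n \<le> jump_time \<omega> (Suc n)"
    by (rule jump_time_mono) simp
  also have "\<dots> < \<infinity>" using \<omega> unfolding jump_cylinder_def by blast
  finally have "jump_time \<omega> n < \<infinity>" .
  moreover have "\<omega> \<in> space M"
    using \<omega> unfolding jump_cylinder_def by blast
  moreover have "jump_chain \<omega> i = y i" if "i \<le> n" for i
  proof -
    have "jump_chain \<omega> i = y' i"
      using \<omega> le_SucI[OF that] unfolding jump_cylinder_def by blast
    then show ?thesis using assms[OF that] by (rule trans)
  qed
  moreover have "ereal 0 < holding_time \<omega> i" if "i < n" for i
    using \<omega> less_SucI[OF that] unfolding jump_cylinder_def by blast
  ultimately show "\<omega> \<in> jump_cylinder M n y"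
    unfolding jump_cylinder_def mem_Collect_eq by (intro conjI allI impI)
qed

lemma jump_cylinder_disjoint:
  assumes "i \<le> n" "y i \<noteq> y' i"
  shows "jump_cylinder M n y \<inter> jump_cylinder M n y' = {}"
proof -
  have "jump_chain \<omega> i = z i" if "\<omega> \<in> jump_cylinder M n z" for \<omega> z
    using that assms(1) by (simp add: jump_cylinder_def)
  then show ?thesis using assms(2) by (metis disjoint_iff)
qed

lemma jump_cylinder_subset_entrance:
  assumes "sets M = sets path_space" "A \<inter> B = {}" "k \<le> j"
    and "\<And>i. k \<le> i \<Longrightarrow> i < j \<Longrightarrow> y i \<notin> A \<union> B" "y j \<in> A"
  shows "jump_cylinder M j y \<subseteq> {\<omega> \<in> space M. entrance_time k A \<omega> < entrance_time k B \<omega>}"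
proof
  fix \<omega> assume \<omega>: "\<omega> \<in> jump_cylinder M j y"
  then have sp: "\<omega> \<in> space M" by (simp add: jump_cylinder_def)
  have "y i \<notin> B" if "k \<le> i" "i \<le> j" for i
    using assms that by (cases "i = j") auto
  then have "entrance_time k A \<omega> < entrance_time k B \<omega>"
    using entrance_time_less_on_cylinder[OF _ \<omega> assms(3)] sp assms(5)
      space_subset_cadlag[OF assms(1)] by blast
  with sp show "\<omega> \<in> {\<omega> \<in> space M. entrance_time k A \<omega> < entrance_time k B \<omega>}" by simp
qed

text \<open>Induction on \<open>n\<close>: a cylinder ending off \<open>A \<union> B\<close>
  contains its disjoint extensions by one state \<open>z\<close>, whose probabilities carry the
  factor \<open>p (y j) z\<close>. Finite families of extensions suffice, as only a lower bound is
  claimed. For \<open>k = 1\<close> the starting state may lie in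
  \<open>A \<union> B\<close>.\<close>

lemma entrance_prob_lower_bound:
  fixes P :: "'a :: countable \<Rightarrow> (real \<Rightarrow> 'a) measure"
  assumes jp: "jump_parameters lam p" and P: "markov_law lam p P"
    and AB: "A \<inter> B = {}" and k: "k \<le> 1"
    and "k \<le> j" "\<And>i. k \<le> i \<Longrightarrow> i < j \<Longrightarrow> y i \<notin> A \<union> B"
  shows "measure (P x) (jump_cylinder (P x) j y) * hit_prob p A B n (y j) \<le>
    measure (P x) ({\<omega> \<in> space (P x). entrance_time k A \<omega> < entrance_time k B \<omega>}
      \<inter> jump_cylinder (P x) j y)"
  using assms(5,6)
proof (induction n arbitrary: j y)
  case 0
  then show ?case
  proof (cases "y j \<in> A")
    case True
    then have "jump_cylinder (P x) j y \<subseteq> {\<omega> \<in> space (P x). entrance_time k A \<omega> < entrance_time k B \<omega>}"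
      using jump_cylinder_subset_entrance[OF markov_lawD(2)[OF P] AB 0] by simp
    then show ?thesis using True by (simp add: Int_absorb1)
  qed simp
next
  case (Suc n)
  let ?M = "P x" and ?E = "{\<omega> \<in> space (P x). entrance_time k A \<omega> < entrance_time k B \<omega>}"
  let ?C = "jump_cylinder (P x)"
  interpret prob_space ?M by (rule markov_lawD[OF P])
  have E: "?E \<in> sets ?M"
    by (rule sets_entrance_time_less[OF markov_lawD(2)[OF P] AB k])
  consider "measure ?M (?C j y) = 0" | "y j \<in> A" | "y j \<in> B - A"
    | "measure ?M (?C j y) \<noteq> 0" "y j \<notin> A \<union> B" by blast
  then show ?case
  proof cases
    case 2
    then have "?C j y \<subseteq> ?E"
      using jump_cylinder_subset_entrance[OF markov_lawD(2)[OF P] AB Suc.prems] by simp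
    then show ?thesis using 2 by (simp add: Int_absorb1)
  next
    case 4
    let ?y = "\<lambda>z. y(Suc j := z)"
    \<comment> \<open>Measurability of a cylinder is read off from its nonzero measure, since
      \<open>measure\<close> is 0 outside the sigma-algebra. This is why null cylinders form a case
      of their own and null extensions are dropped in \<open>Y'\<close>.\<close>
    have Cj: "?C j y \<in> sets ?M"
      using 4(1) measure_notin_sets by blast
    have step: "measure ?M (?C (Suc j) (?y z)) = measure ?M (?C j y) * p (y j) z" for z
      unfolding measure_jump_cylinder[OF P] by simp
    have sub: "?C (Suc j) (?y z) \<subseteq> ?C j y" for z
      by (rule jump_cylinder_Suc_subset) simp
    have partial: "(\<Sum>z\<in>Y. measure ?M (?C j y) * (p (y j) z * hit_prob p A B n z)) \<le>
        measure ?M (?E \<inter> ?C j y)" if "finite Y" for Y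
    proof -
      define Y' where "Y' = {z \<in> Y. measure ?M (?C (Suc j) (?y z)) \<noteq> 0}"
      have Y': "finite Y'" using that by (simp add: Y'_def)
      have sets: "?E \<inter> ?C (Suc j) (?y z) \<in> sets ?M" if "z \<in> Y'" for z
        using that E measure_notin_sets[of "?C (Suc j) (?y z)" ?M] by (auto simp: Y'_def)
      have "(\<Sum>z\<in>Y. measure ?M (?C j y) * (p (y j) z * hit_prob p A B n z)) =
          (\<Sum>z\<in>Y. measure ?M (?C (Suc j) (?y z)) * hit_prob p A B n (?y z (Suc j)))"
        by (simp add: step mult.assoc)
      also have "\<dots> = (\<Sum>z\<in>Y'. measure ?M (?C (Suc j) (?y z)) * hit_prob p A B n (?y z (Suc j)))"
        using that by (intro sum.mono_neutral_right) (auto simp: Y'_def)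
      also have "\<dots> \<le> (\<Sum>z\<in>Y'. measure ?M (?E \<inter> ?C (Suc j) (?y z)))"
      proof (intro sum_mono Suc.IH)
        fix z i assume "k \<le> i" "i < Suc j"
        then show "(?y z) i \<notin> A \<union> B"
          using Suc.prems(2)[of i] 4(2) by (cases "i = j") auto
      qed (use Suc.prems(1) in simp)
      also have "\<dots> = measure ?M (\<Union>z\<in>Y'. ?E \<inter> ?C (Suc j) (?y z))"
      proof (rule finite_measure_finite_Union[symmetric])
        show "disjoint_family_on (\<lambda>z. ?E \<inter> ?C (Suc j) (?y z)) Y'"
        unfolding disjoint_family_on_def
      proof (intro ballI impI)
        fix z z' :: 'a assume "z \<noteq> z'"
        then have "?C (Suc j) (?y z) \<inter> ?C (Suc j) (?y z') = {}"
          by (intro jump_cylinder_disjoint[of "Suc j"]) auto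
        then show "(?E \<inter> ?C (Suc j) (?y z)) \<inter> (?E \<inter> ?C (Suc j) (?y z')) = {}" by blast
      qed
      qed (use Y' sets in auto)
      also have "\<dots> \<le> measure ?M (?E \<inter> ?C j y)"
        by (intro finite_measure_mono) (use sub E Cj in auto)
      finally show ?thesis .
    qed
    have "measure ?M (?C j y) * (\<Sum>\<^sub>\<infinity>z. p (y j) z * hit_prob p A B n z) =
        (\<Sum>\<^sub>\<infinity>z. measure ?M (?C j y) * (p (y j) z * hit_prob p A B n z))"
      by (rule infsum_cmult_right'[symmetric])
    also have "\<dots> \<le> measure ?M (?E \<inter> ?C j y)"
      using partial hit_prob_bounds[OF jp]
      by (intro infsum_le_finite_sums summable_on_cmult_right weighted_jump_sum(1)[OF jp]) auto
    finally show ?thesis using 4(2) by simp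
  qed auto
qed

lemma hit_prob_le_entrance_prob:
  fixes P :: "'a :: countable \<Rightarrow> (real \<Rightarrow> 'a) measure"
  assumes jp: "jump_parameters lam p" and P: "markov_law lam p P" and AB: "A \<inter> B = {}"
  shows "hit_prob p A B n x \<le>
    measure (P x) {\<omega> \<in> space (P x). entrance_time 0 A \<omega> < entrance_time 0 B \<omega>}"
proof -
  interpret prob_space "P x" by (rule markov_lawD[OF P])
  have "hit_prob p A B n x \<le> measure (P x)
     ({\<omega> \<in> space (P x). entrance_time 0 A \<omega> < entrance_time 0 B \<omega>} \<inter> jump_cylinder (P x) 0 (\<lambda>_. x))"
    using entrance_prob_lower_bound[OF jp P AB, of 0 0 "\<lambda>_. x" x n]
    by (simp add: measure_jump_cylinder[OF P])
  also have "\<dots> \<le> measure (P x) {\<omega> \<in> space (P x). entrance_time 0 A \<omega> < entrance_time 0 B \<omega>}"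
    by (intro finite_measure_mono sets_entrance_time_less[OF markov_lawD(2)[OF P] AB]) auto
  finally show ?thesis .
qed

text \<open>The cylinders of one jump from \<open>x\<close> to \<open>z\<close> are disjoint, and
  with \<open>k = j = 1\<close> the bound applies to each of them without any condition on
  \<open>x\<close>; it will be used with \<open>x \<in> A\<close>.\<close>

lemma hit_prob_sum_le_return_prob:
  fixes P :: "'a :: countable \<Rightarrow> (real \<Rightarrow> 'a) measure"
  assumes jp: "jump_parameters lam p" and P: "markov_law lam p P" and AB: "A \<inter> B = {}"
    and "finite Y"
  shows "(\<Sum>y\<in>Y. p x y * hit_prob p A B n y) \<le>
    measure (P x) {\<omega> \<in> space (P x). entrance_time 1 A \<omega> < entrance_time 1 B \<omega>}"
proof -
  let ?E = "{\<omega> \<in> space (P x). entrance_time 1 A \<omega> < entrance_time 1 B \<omega>}"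
  let ?C = "\<lambda>z. jump_cylinder (P x) 1 (\<lambda>i. if i = 0 then x else z)"
  interpret prob_space "P x" by (rule markov_lawD[OF P])
  have E: "?E \<in> sets (P x)"
    by (rule sets_entrance_time_less[OF markov_lawD(2)[OF P] AB]) simp
  have C: "measure (P x) (?C z) = p x z" for z
    by (simp add: measure_jump_cylinder[OF P])
  define Y' where "Y' = {z \<in> Y. p x z \<noteq> 0}"
  have "finite Y'" using assms(4) by (simp add: Y'_def)
  have sets: "?E \<inter> ?C z \<in> sets (P x)" if "z \<in> Y'" for z
    using that C[of z] E measure_notin_sets[of "?C z" "P x"] by (auto simp: Y'_def)
  have "(\<Sum>y\<in>Y. p x y * hit_prob p A B n y) = (\<Sum>y\<in>Y'. p x y * hit_prob p A B n y)"
    using assms(4) by (intro sum.mono_neutral_right) (auto simp: Y'_def)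
  also have "\<dots> \<le> (\<Sum>z\<in>Y'. measure (P x) (?E \<inter> ?C z))"
  proof (rule sum_mono)
    fix z
    show "p x z * hit_prob p A B n z \<le> measure (P x) (?E \<inter> ?C z)"
      using entrance_prob_lower_bound[OF jp P AB, of 1 1 "\<lambda>i. if i = 0 then x else z" x n] C[of z]
      by simp
  qed
  also have "\<dots> = measure (P x) (\<Union>z\<in>Y'. ?E \<inter> ?C z)"
  proof (rule finite_measure_finite_Union[symmetric])
    show "disjoint_family_on (\<lambda>z. ?E \<inter> ?C z) Y'"
      unfolding disjoint_family_on_def
    proof (intro ballI impI)
      fix z z' :: 'a assume "z \<noteq> z'"
      then have "?C z \<inter> ?C z' = {}"
        by (intro jump_cylinder_disjoint[of 1]) auto
      then show "(?E \<inter> ?C z) \<inter> (?E \<inter> ?C z') = {}" by blast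
    qed
  qed (use \<open>finite Y'\<close> sets in auto)
  also have "\<dots> \<le> measure (P x) ?E"
    by (intro finite_measure_mono E) auto
  finally show ?thesis .
qed

section \<open>Irreducibility and the limit of the hitting probabilities\<close>

lemma irreducible_jump_path:
  assumes "jump_parameters lam p" "irreducible_rates (jump_rate lam p)"
  shows "(x, y) \<in> {(u, v). lam u \<noteq> 0 \<and> 0 < p u v}\<^sup>*"
proof -
  have "{(u, v). 0 < jump_rate lam p u v} \<subseteq> {(u, v). lam u \<noteq> 0 \<and> 0 < p u v}"
    using jump_parametersD(1,2)[OF assms(1)]
    by (auto simp: jump_rate_def zero_less_mult_iff order.strict_iff_order)
  then show ?thesis
    using assms(2) rtrancl_mono unfolding irreducible_rates_def by blast
qed

lemma irreducible_rate_nonzero: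
  assumes "jump_parameters lam p" "irreducible_rates (jump_rate lam p)" "x \<noteq> y"
  shows "lam x \<noteq> 0"
  using irreducible_jump_path[OF assms(1,2), of x y] assms(3) by (auto elim: converse_rtranclE)

text \<open>The maximum principle: from a maximum point the chain cannot leave the set where the maximum is attained.\<close>

lemma harmonic_vanishing_outside_finite_eq_0:
  assumes jp: "jump_parameters lam p" and irr: "irreducible_rates (jump_rate lam p)"
    and D: "finite D" "D \<noteq> UNIV"
    and c: "\<And>x. 0 \<le> c x" "\<And>x. x \<notin> D \<Longrightarrow> c x = 0"
      "\<And>x. x \<in> D \<Longrightarrow> c x = (\<Sum>y\<in>D. p x y * c y)"
  shows "c x = 0"
proof (rule ccontr)
  assume "c x \<noteq> 0"
  then have "x \<in> D" using c(2) by blast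
  define m where "m = Max (c ` D)"
  have "m \<in> c ` D" unfolding m_def using D(1) \<open>x \<in> D\<close> by (intro Max_in) auto
  then obtain z where z: "z \<in> D" "c z = m" by blast
  have le: "c y \<le> m" if "y \<in> D" for y
    unfolding m_def using D(1) that by simp
  have "m > 0" using le[OF \<open>x \<in> D\<close>] c(1)[of x] \<open>c x \<noteq> 0\<close> by linarith
  have in_max: "v \<in> D \<and> c v = m" if u: "u \<in> D" "c u = m" and p: "0 < p u v" for u v
  proof (rule ccontr)
    assume "\<not> (v \<in> D \<and> c v = m)"
    then have v: "c v < m" using le[of v] c(2)[of v] \<open>m > 0\<close> by fastforce
    have sum: "(\<Sum>y\<in>insert v D. p u y) \<le> 1"
      using finite_sum_le_has_sum[OF jump_parametersD(4)[OF jp, of u], of "insert v D"] D(1)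
        jump_parametersD(2)[OF jp] by (auto split: if_splits)
    \<comment> \<open>Adding \<open>v\<close> does not change the sum, as \<open>c\<close> vanishes
      off \<open>D\<close>, but it exhibits a positive weight on a value below \<open>m\<close>.
      With total weight at most 1 the average falls below \<open>m\<close>.\<close>
    have "m = (\<Sum>y\<in>insert v D. p u y * c y)"
      using c(3)[OF u(1)] u(2) c(2)[of v] D(1) by (cases "v \<in> D") (auto simp: insert_absorb)
    also have "\<dots> < (\<Sum>y\<in>insert v D. p u y * m)"
    proof (rule sum_strict_mono_ex1)
      show "\<forall>y\<in>insert v D. p u y * c y \<le> p u y * m"
        using le v jump_parametersD(2)[OF jp] by (auto intro!: mult_left_mono)
      show "\<exists>y\<in>insert v D. p u y * c y < p u y * m" using p v by auto
    qed (use D(1) in simp)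
    also have "\<dots> = (\<Sum>y\<in>insert v D. p u y) * m" by (rule sum_distrib_right[symmetric])
    also have "\<dots> \<le> 1 * m" using sum \<open>m > 0\<close> by (intro mult_right_mono) auto
    finally show False by simp
  qed
  obtain w where "w \<notin> D" using D(2) by blast
  have "w \<in> D \<and> c w = m"
    using irreducible_jump_path[OF jp irr, of z w]
  proof (induction rule: rtrancl_induct)
    case base
    then show ?case using z by simp
  next
    case (step u v)
    then show ?case using in_max[of u v] by simp
  qed
  then show False using \<open>w \<notin> D\<close> by simp
qed

text \<open>The probability not to have entered \<open>A \<union> B\<close> is supported in the finite set
  \<open>- (A \<union> B)\<close>, so its limit is a finite harmonic function.\<close>

lemma hit_prob_tendsto:
  assumes jp: "jump_parameters lam p" and irr: "irreducible_rates (jump_rate lam p)"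
    and AB: "A \<inter> B = {}" "A \<union> B \<noteq> {}" "finite (- B)"
  shows "(\<lambda>n. hit_prob p A B n x + hit_prob p B A n x) \<longlonglongrightarrow> 1"
proof -
  define D where "D = - (A \<union> B)"
  define c where "c n x = 1 - (hit_prob p A B n x + hit_prob p B A n x)" for n x
  have D: "finite D" "D \<noteq> UNIV" using AB finite_subset[of D "- B"] by (auto simp: D_def)
  have c_out: "c n x = 0" if "x \<notin> D" for n x
    using that AB(1) by (cases n) (auto simp: c_def D_def)
  have c_0: "c 0 x = 1" if "x \<in> D" for x using that by (simp add: c_def D_def)
  \<comment> \<open>Row \<open>x\<close> of \<open>p\<close> has mass 1, so the complement
    \<open>c\<close> obeys the same one-step recursion. As \<open>c\<close> vanishes off
    \<open>D\<close>, the sum is finite and limits may be taken term by term.\<close>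
  have c_Suc: "c (Suc n) x = (\<Sum>y\<in>D. p x y * c n y)" if x: "x \<in> D" for n x
  proof -
    obtain w where "w \<notin> D" using D(2) by blast
    then have "x \<noteq> w" using x by blast
    then have "lam x \<noteq> 0" by (rule irreducible_rate_nonzero[OF jp irr])
    note s = weighted_jump_sum(1)[OF jp, THEN has_sum_infsum]
    have "((\<lambda>y. p x y - (p x y * hit_prob p A B n y + p x y * hit_prob p B A n y)) has_sum
        (1 - ((\<Sum>\<^sub>\<infinity>y. p x y * hit_prob p A B n y) + (\<Sum>\<^sub>\<infinity>y. p x y * hit_prob p B A n y)))) UNIV"
      using hit_prob_bounds[OF jp]
      by (intro has_sum_minus has_sum_add jump_parametersD(5)[OF jp \<open>lam x \<noteq> 0\<close>] s) auto
    then have "((\<lambda>y. p x y * c n y) has_sum c (Suc n) x) UNIV"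
      using x by (simp add: c_def D_def algebra_simps)
    moreover have "((\<lambda>y. p x y * c n y) has_sum (\<Sum>y\<in>D. p x y * c n y)) UNIV"
      by (rule has_sum_finite_neutralI[OF D(1)]) (use c_out in auto)
    ultimately show ?thesis by (rule has_sum_unique)
  qed
  have c_nonneg: "0 \<le> c n x" for n x
  proof (induction n arbitrary: x)
    case 0
    then show ?case using c_0 c_out by (cases "x \<in> D") auto
  next
    case (Suc n)
    then show ?case using c_Suc c_out jump_parametersD(2)[OF jp]
      by (cases "x \<in> D") (auto intro!: sum_nonneg)
  qed
  have c_dec: "c (Suc n) x \<le> c n x" for n x
  proof (induction n arbitrary: x)
    case 0
    have "c (Suc 0) x \<le> 1"
      using hit_prob_bounds[OF jp, of A B 1 x] hit_prob_bounds[OF jp, of B A 1 x] by (simp add: c_def)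
    then show ?case using c_0 c_out by (cases "x \<in> D") auto
  next
    case (Suc n)
    show ?case
    proof (cases "x \<in> D")
      case True
      then show ?thesis unfolding c_Suc[OF True]
        using Suc jump_parametersD(2)[OF jp] by (intro sum_mono mult_left_mono)
    qed (simp add: c_out)
  qed
  have "convergent (\<lambda>n. c n x)" for x
    by (rule Bseq_monoseq_convergent)
       (use c_nonneg decseq_SucI[of "\<lambda>n. c n x"] c_dec in
        \<open>auto intro!: decseq_bounded decseq_imp_monoseq\<close>)
  then have lim: "(\<lambda>n. c n x) \<longlonglongrightarrow> lim (\<lambda>n. c n x)" for x
    by (simp add: convergent_LIMSEQ_iff)
  have "lim (\<lambda>n. c n x) = 0" for x
  proof (rule harmonic_vanishing_outside_finite_eq_0[OF jp irr D])
    show "0 \<le> lim (\<lambda>n. c n x)" for x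
      by (rule LIMSEQ_le_const[OF lim]) (use c_nonneg in auto)
    show "lim (\<lambda>n. c n x) = 0" if "x \<notin> D" for x
      using c_out[OF that] by simp
    show "lim (\<lambda>n. c n x) = (\<Sum>y\<in>D. p x y * lim (\<lambda>n. c n y))" if "x \<in> D" for x
    proof (rule LIMSEQ_unique)
      show "(\<lambda>n. c (Suc n) x) \<longlonglongrightarrow> lim (\<lambda>n. c n x)" using lim by (rule LIMSEQ_Suc)
      show "(\<lambda>n. c (Suc n) x) \<longlonglongrightarrow> (\<Sum>y\<in>D. p x y * lim (\<lambda>n. c n y))"
        unfolding c_Suc[OF that] by (intro tendsto_intros lim)
    qed
  qed
  then have "(\<lambda>n. 1 - c n x) \<longlonglongrightarrow> 1 - 0" using lim[of x] by (intro tendsto_intros) simp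
  then show ?thesis by (simp add: c_def)
qed

text \<open>Entering \<open>A\<close> first and entering \<open>B\<close> first are disjoint events,
  so their probabilities add up to at most 1. Their lower bounds add up to 1 in the limit, hence
  each bound is attained and the second event has probability \<open>1 - V\<close>.\<close>

lemma equilibrium_potential_limits:
  fixes P :: "'a :: countable \<Rightarrow> (real \<Rightarrow> 'a) measure"
  assumes jp: "jump_parameters lam p" and irr: "irreducible_rates (jump_rate lam p)"
    and P: "markov_law lam p P"
    and AB: "A \<inter> B = {}" "A \<union> B \<noteq> {}" "finite (- B)"
  shows "(\<lambda>n. hit_prob p A B n x) \<longlonglongrightarrow> equilibrium_potential P A B x"
    "(\<lambda>n. hit_prob p B A n x) \<longlonglongrightarrow> 1 - equilibrium_potential P A B x"
    "hit_prob p A B n x \<le> equilibrium_potential P A B x"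
    "hit_prob p B A n x \<le> 1 - equilibrium_potential P A B x"
proof -
  interpret prob_space "P x" by (rule markov_lawD[OF P])
  let ?V = "equilibrium_potential P A B x"
  let ?E = "{\<omega> \<in> space (P x). entrance_time 0 A \<omega> < entrance_time 0 B \<omega>}"
  let ?E' = "{\<omega> \<in> space (P x). entrance_time 0 B \<omega> < entrance_time 0 A \<omega>}"
  have BA: "B \<inter> A = {}" using AB(1) by blast
  have V: "?V = measure (P x) ?E"
    by (simp add: equilibrium_potential_def hitting_time_eq_entrance)
  have "?E \<in> events" "?E' \<in> events"
    using sets_entrance_time_less[OF markov_lawD(2)[OF P]] AB(1) BA by simp_all
  then have "measure (P x) ?E + measure (P x) ?E' = measure (P x) (?E \<union> ?E')"
    by (intro finite_measure_Union[symmetric]) (auto dest: less_asym)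
  then have le1: "?V + measure (P x) ?E' \<le> 1" using V by simp
  show a: "hit_prob p A B n x \<le> ?V" for n
    using hit_prob_le_entrance_prob[OF jp P AB(1), of n x] V by simp
  show b: "hit_prob p B A n x \<le> 1 - ?V" for n
    using hit_prob_le_entrance_prob[OF jp P BA, of n x] le1 by linarith
  have lim: "(\<lambda>n. hit_prob p A B n x + hit_prob p B A n x) \<longlonglongrightarrow> 1"
    by (rule hit_prob_tendsto[OF jp irr AB])
  \<comment> \<open>Lower envelopes for the two sandwiches: one summand is the sum minus the other,
    and the other is at most \<open>1 - ?V\<close> or \<open>?V\<close>; these are the cases
    \<open>c = ?V\<close> and \<open>c = 1 - ?V\<close>.\<close>
  have lo: "(\<lambda>n. (hit_prob p A B n x + hit_prob p B A n x) - (1 - c)) \<longlonglongrightarrow> 1 - (1 - c)" for c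
    by (intro tendsto_intros lim)
  show "(\<lambda>n. hit_prob p A B n x) \<longlonglongrightarrow> ?V"
  proof (rule tendsto_sandwich)
    show "(\<lambda>n. (hit_prob p A B n x + hit_prob p B A n x) - (1 - ?V)) \<longlonglongrightarrow> ?V"
      using lo[of ?V] by simp
    show "\<forall>\<^sub>F n in sequentially. (hit_prob p A B n x + hit_prob p B A n x) - (1 - ?V) \<le> hit_prob p A B n x"
      using b by (intro always_eventually) (auto simp: algebra_simps)
  qed (use a in auto)
  show "(\<lambda>n. hit_prob p B A n x) \<longlonglongrightarrow> 1 - ?V"
  proof (rule tendsto_sandwich)
    show "(\<lambda>n. (hit_prob p A B n x + hit_prob p B A n x) - ?V) \<longlonglongrightarrow> 1 - ?V"
      using lo[of "1 - ?V"] by simp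
    show "\<forall>\<^sub>F n in sequentially. (hit_prob p A B n x + hit_prob p B A n x) - ?V \<le> hit_prob p B A n x"
      using a by (intro always_eventually) (auto simp: algebra_simps)
  qed (use b in auto)
qed

text \<open>In the limit \<open>u\<close> is at least the \<open>q\<close>-mean of \<open>V\<close>
  and \<open>w\<close> at least that of \<open>1 - V\<close>. These means add up to 1, so
  \<open>u + w \<le> 1\<close> leaves no slack. It serves both for harmonicity off
  \<open>A \<union> B\<close> and for the return probabilities on \<open>A\<close>.\<close>

lemma first_step_split:
  fixes q V :: "'a \<Rightarrow> real" and a b :: "nat \<Rightarrow> 'a \<Rightarrow> real"
  assumes q: "(q has_sum 1) UNIV" "\<And>y. 0 \<le> q y"
    and V: "\<And>y. 0 \<le> V y" "\<And>y. V y \<le> 1" "finite K" "\<And>y. y \<notin> K \<Longrightarrow> V y = 0"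
    and lim: "\<And>y. (\<lambda>n. a n y) \<longlonglongrightarrow> V y" "\<And>y. (\<lambda>n. b n y) \<longlonglongrightarrow> 1 - V y"
    and u: "\<And>n Y. finite Y \<Longrightarrow> (\<Sum>y\<in>Y. q y * a n y) \<le> u"
    and w: "\<And>n Y. finite Y \<Longrightarrow> (\<Sum>y\<in>Y. q y * b n y) \<le> w"
    and "u + w \<le> 1"
  shows "u = (\<Sum>y\<in>K. q y * V y)" "w = 1 - (\<Sum>y\<in>K. q y * V y)"
proof -
  have uK: "(\<Sum>y\<in>K. q y * V y) \<le> u"
    by (rule LIMSEQ_le_const2[where X = "\<lambda>n. \<Sum>y\<in>K. q y * a n y"])
      (use u[OF V(3)] in \<open>auto intro!: tendsto_intros lim\<close>)
  have wY: "(\<Sum>y\<in>Y. q y * (1 - V y)) \<le> w" if "finite Y" for Y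
    by (rule LIMSEQ_le_const2[where X = "\<lambda>n. \<Sum>y\<in>Y. q y * b n y"])
      (use w[OF that] in \<open>auto intro!: tendsto_intros lim\<close>)
  have "((\<lambda>y. q y * V y) has_sum (\<Sum>y\<in>K. q y * V y)) UNIV"
    by (rule has_sum_finite_neutralI[OF V(3)]) (use V(4) in auto)
  then have "((\<lambda>y. q y * (1 - V y)) has_sum (1 - (\<Sum>y\<in>K. q y * V y))) UNIV"
    using has_sum_minus[OF q(1)] by (simp add: right_diff_distrib)
  then have "1 - (\<Sum>y\<in>K. q y * V y) \<le> w"
    by (rule has_sum_le_finite_sums) (use wY in auto)
  then show "u = (\<Sum>y\<in>K. q y * V y)" "w = 1 - (\<Sum>y\<in>K. q y * V y)"
    using uK assms(11) by linarith+
qed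

text \<open>The lower bounds of level \<open>n = 0\<close> are already exact on \<open>A\<close> and
  on \<open>B\<close>.\<close>

lemma equilibrium_potential_boundary:
  fixes P :: "'a :: countable \<Rightarrow> (real \<Rightarrow> 'a) measure"
  assumes jp: "jump_parameters lam p" and irr: "irreducible_rates (jump_rate lam p)"
    and P: "markov_law lam p P"
    and AB: "A \<inter> B = {}" "finite (- B)"
  shows "x \<in> A \<Longrightarrow> equilibrium_potential P A B x = 1"
    "x \<in> B \<Longrightarrow> equilibrium_potential P A B x = 0"
proof -
  interpret prob_space "P x" by (rule markov_lawD[OF P])
  note lim = equilibrium_potential_limits[OF jp irr P AB(1) _ AB(2)]
  show "equilibrium_potential P A B x = 1" if "x \<in> A"
    using lim(3)[of 0 x] that prob_le_1[of "{\<omega> \<in> space (P x). hitting_time A \<omega> < hitting_time B \<omega>}"]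
    by (auto simp: equilibrium_potential_def)
  show "equilibrium_potential P A B x = 0" if "x \<in> B"
    using lim(4)[of 0 x] that measure_nonneg[of "P x" "{\<omega> \<in> space (P x). hitting_time A \<omega> < hitting_time B \<omega>}"]
    by (auto simp: equilibrium_potential_def)
qed

lemma equilibrium_potential_bounds:
  assumes "markov_law lam p P"
  shows "0 \<le> equilibrium_potential P A B x" "equilibrium_potential P A B x \<le> 1"
  using prob_space.prob_le_1[OF markov_lawD(1)[OF assms]]
  by (auto simp: equilibrium_potential_def)

lemma equilibrium_potential_harmonic:
  fixes P :: "'a :: countable \<Rightarrow> (real \<Rightarrow> 'a) measure"
  assumes jp: "jump_parameters lam p" and irr: "irreducible_rates (jump_rate lam p)"
    and P: "markov_law lam p P"
    and AB: "A \<inter> B = {}" "finite (- B)" and x: "x \<notin> A \<union> B"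
  shows "lam x * equilibrium_potential P A B x =
    (\<Sum>y\<in>- B. jump_rate lam p x y * equilibrium_potential P A B y)"
proof (cases "A \<union> B = {}")
  case True
  \<comment> \<open>Both hitting times are infima of the empty set, so neither is smaller and the
    potential is 0 everywhere.\<close>
  then show ?thesis
    by (simp add: equilibrium_potential_def hitting_time_def)
next
  case False
  let ?V = "equilibrium_potential P A B"
  note lim = equilibrium_potential_limits[OF jp irr P AB(1) False AB(2)]
  obtain w where "w \<in> A \<union> B" using False by blast
  then have "x \<noteq> w" using x by blast
  then have "lam x \<noteq> 0" by (rule irreducible_rate_nonzero[OF jp irr])
  have part: "(\<Sum>y\<in>Y. p x y * hit_prob p C D n y) \<le> hit_prob p C D (Suc n) x"
    if "finite Y" "x \<notin> C \<union> D" for C D Y n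
    using that finite_sum_le_infsum[OF weighted_jump_sum(1)[OF jp, of "hit_prob p C D n" x], of Y]
      hit_prob_bounds[OF jp, of C D n] jump_parametersD(2)[OF jp] by auto
  have "?V x = (\<Sum>y\<in>-B. p x y * ?V y)"
  \<comment> \<open>With \<open>u = ?V x\<close> and \<open>w = 1 - ?V x\<close> the condition
    \<open>u + w \<le> 1\<close> is an identity; the bounds for level \<open>n\<close> come from
    level \<open>Suc n\<close> at \<open>x\<close>.\<close>
  proof (rule first_step_split(1)[where a = "hit_prob p A B" and b = "hit_prob p B A" and w = "1 - ?V x"])
    show "(p x has_sum 1) UNIV" by (rule jump_parametersD(5)[OF jp \<open>lam x \<noteq> 0\<close>])
    show "(\<Sum>y\<in>Y. p x y * hit_prob p A B n y) \<le> ?V x" if "finite Y" for n Y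
      using part[OF that, of A B n] x lim(3)[of "Suc n" x] by (meson order_trans)
    show "(\<Sum>y\<in>Y. p x y * hit_prob p B A n y) \<le> 1 - ?V x" if "finite Y" for n Y
      using part[OF that, of B A n] x lim(4)[of "Suc n" x] by (metis order_trans sup_commute)
  qed (use jump_parametersD(2)[OF jp] equilibrium_potential_bounds[OF P] AB(2)
      equilibrium_potential_boundary(2)[OF jp irr P AB] lim(1,2) in auto)
  then show ?thesis
    by (simp add: jump_rate_def sum_distrib_left mult.assoc)
qed

text \<open>By a first step from \<open>x \<in> A\<close>, the probability of returning to
  \<open>B\<close> before \<open>A\<close> is \<open>1\<close> minus the \<open>p x\<close>-mean of
  the potential. So the capacity is the sum of \<open>mu\<close> times \<open>-L V\<close> over
  \<open>A\<close>.\<close>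

lemma capacity_eq_sum:
  fixes P :: "'a :: countable \<Rightarrow> (real \<Rightarrow> 'a) measure"
  assumes jp: "jump_parameters lam p" and irr: "irreducible_rates (jump_rate lam p)"
    and P: "markov_law lam p P"
    and AB: "A \<inter> B = {}" "finite (- B)"
  shows "capacity lam mu P A B =
    (\<Sum>x\<in>A. mu x * (lam x - (\<Sum>y\<in>- B. jump_rate lam p x y * equilibrium_potential P A B y)))"
proof -
  let ?V = "equilibrium_potential P A B"
  have "finite A" using AB finite_subset[of A "- B"] by blast
  have "mu x * lam x * measure (P x) {\<omega> \<in> space (P x). return_time B \<omega> < return_time A \<omega>} =
    mu x * (lam x - (\<Sum>y\<in>- B. jump_rate lam p x y * ?V y))" if "x \<in> A" for x
  proof (cases "lam x = 0")
    case True
    then show ?thesis by (simp add: jump_rate_def)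
  next
    case False
    interpret prob_space "P x" by (rule markov_lawD[OF P])
    have ne: "A \<union> B \<noteq> {}" using that by blast
    have BA: "B \<inter> A = {}" using AB(1) by blast
    note lim = equilibrium_potential_limits[OF jp irr P AB(1) ne AB(2)]
    let ?E = "{\<omega> \<in> space (P x). entrance_time 1 A \<omega> < entrance_time 1 B \<omega>}"
    let ?E' = "{\<omega> \<in> space (P x). entrance_time 1 B \<omega> < entrance_time 1 A \<omega>}"
    have "measure (P x) ?E' = 1 - (\<Sum>y\<in>-B. p x y * ?V y)"
    proof (rule first_step_split(2)[where a = "hit_prob p A B" and b = "hit_prob p B A"
            and u = "measure (P x) ?E"])
      show "(p x has_sum 1) UNIV" by (rule jump_parametersD(5)[OF jp False])
      have "?E \<in> events" "?E' \<in> events"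
        using sets_entrance_time_less[OF markov_lawD(2)[OF P]] AB(1) BA by simp_all
      then have "measure (P x) ?E + measure (P x) ?E' = measure (P x) (?E \<union> ?E')"
        by (intro finite_measure_Union[symmetric]) (auto dest: less_asym)
      then show "measure (P x) ?E + measure (P x) ?E' \<le> 1" by simp
    qed (use jump_parametersD(2)[OF jp] equilibrium_potential_bounds[OF P] AB(2)
        equilibrium_potential_boundary(2)[OF jp irr P AB] lim(1,2)
        hit_prob_sum_le_return_prob[OF jp P AB(1)] hit_prob_sum_le_return_prob[OF jp P BA] in auto)
    moreover have "(\<Sum>y\<in>-B. jump_rate lam p x y * ?V y) = lam x * (\<Sum>y\<in>-B. p x y * ?V y)"
      by (simp add: jump_rate_def sum_distrib_left mult.assoc)
    ultimately show ?thesis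
      by (simp add: return_time_eq_entrance right_diff_distrib)
  qed
  then show ?thesis
    unfolding capacity_def infsum_finite[OF \<open>finite A\<close>] by (intro sum.cong refl)
qed

section \<open>The adjoint rates\<close>

text \<open>The row sums are the stationarity equation divided by \<open>mu x\<close>. The third
  claim makes the division by \<open>lam x\<close> in \<open>adjoint_prob\<close> harmless at
  \<open>lam x = 0\<close>: the row vanishes there.\<close>

lemma adjoint_rate_sums:
  assumes "jump_parameters lam p" "stationary_measure lam (jump_rate lam p) mu"
  shows "(adjoint_rate mu (jump_rate lam p) x has_sum lam x) UNIV"
    "0 \<le> adjoint_rate mu (jump_rate lam p) x y"
    "lam x = 0 \<Longrightarrow> adjoint_rate mu (jump_rate lam p) x y = 0"
proof -
  have mu: "0 < mu x" for x
    using assms(2) by (simp add: stationary_measure_def)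
  have sum: "((\<lambda>y. mu y * jump_rate lam p y x) has_sum (mu x * lam x)) UNIV"
    using assms(2) by (simp add: stationary_measure_def)
  show *: "(adjoint_rate mu (jump_rate lam p) x has_sum lam x) UNIV"
    unfolding adjoint_rate_def
    using has_sum_cmult_left[OF sum, of "1 / mu x"] mu[of x] by (simp add: field_simps)
  show nonneg: "0 \<le> adjoint_rate mu (jump_rate lam p) x y" for y
    using jump_parametersD(1,2)[OF assms(1)] mu[of x] mu[of y]
    by (simp add: adjoint_rate_def jump_rate_def)
  show "adjoint_rate mu (jump_rate lam p) x y = 0" if "lam x = 0"
    using finite_sum_le_has_sum[OF *, of "{y}"] nonneg that by (simp add: antisym)
qed

lemma jump_rate_adjoint_prob:
  assumes "jump_parameters lam p" "stationary_measure lam (jump_rate lam p) mu"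
  shows "jump_rate lam (adjoint_prob lam mu p) = adjoint_rate mu (jump_rate lam p)"
  using adjoint_rate_sums(3)[OF assms] by (auto simp: fun_eq_iff jump_rate_def adjoint_prob_def)

text \<open>Puts the adjoint process into the same framework, so that all results on
  \<open>P\<close> can be applied to \<open>Ps\<close>.\<close>

lemma jump_parameters_adjoint:
  assumes "jump_parameters lam p" "stationary_measure lam (jump_rate lam p) mu"
  shows "jump_parameters lam (adjoint_prob lam mu p)"
  unfolding jump_parameters_def
proof (intro conjI allI)
  fix x y
  show "0 \<le> lam x" by (rule jump_parametersD[OF assms(1)])
  show "0 \<le> adjoint_prob lam mu p x y"
    using adjoint_rate_sums(2)[OF assms] jump_parametersD(1)[OF assms(1)] by (simp add: adjoint_prob_def)
  show "adjoint_prob lam mu p x x = 0"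
    using jump_parametersD(3)[OF assms(1)] by (simp add: adjoint_prob_def adjoint_rate_def jump_rate_def)
  show "(adjoint_prob lam mu p x has_sum (if lam x = 0 then 0 else 1)) UNIV"
    using has_sum_cmult_left[OF adjoint_rate_sums(1)[OF assms], of x "1 / lam x"]
    unfolding adjoint_prob_def[abs_def] by (auto simp: field_simps)
qed

lemma irreducible_adjoint_rate:
  assumes "irreducible_rates r" "\<And>x. 0 < mu x"
  shows "irreducible_rates (adjoint_rate mu r)"
proof -
  have "{(u, v). 0 < adjoint_rate mu r u v} = {(u, v). 0 < r u v}\<inverse>"
    by (simp add: converse_unfold adjoint_rate_def zero_less_mult_iff zero_less_divide_iff assms(2) less_not_sym[OF assms(2)])
  then show ?thesis
    using assms(1) by (auto simp: irreducible_rates_def rtrancl_converse)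
qed

section \<open>The Dirichlet form\<close>

lemma has_sum_finite_sum:
  fixes f :: "'b \<Rightarrow> 'a \<Rightarrow> real"
  assumes "finite I" "\<And>i. i \<in> I \<Longrightarrow> (f i has_sum s i) X"
  shows "((\<lambda>x. \<Sum>i\<in>I. f i x) has_sum (\<Sum>i\<in>I. s i)) X"
  using assms by (induction I rule: finite_induct) (auto intro!: has_sum_add)

text \<open>Passing to the adjoint exchanges the row sums \<open>r_sum\<close> with the column sums
  \<open>stationary\<close>, so everything proved here holds for both generators. \<open>K\<close>
  becomes the complement of \<open>B\<close>.\<close>

locale stationary_rates =
  fixes lam mu :: "'a \<Rightarrow> real" and r :: "'a \<Rightarrow> 'a \<Rightarrow> real" and K :: "'a set"
  assumes mu_pos: "0 < mu x" and r_nonneg: "0 \<le> r x y"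
    and r_sum: "(r x has_sum lam x) UNIV"
    and stationary: "((\<lambda>x. mu x * r x y) has_sum (mu y * lam y)) UNIV"
    and finite_K: "finite K"
begin

text \<open>The form \<open>D(f,g)\<close> with \<open>f\<close> and \<open>g\<close> read as 0 off
  \<open>K\<close>; as a finite sum it is bilinear in arbitrary functions.\<close>

definition form :: "('a \<Rightarrow> real) \<Rightarrow> ('a \<Rightarrow> real) \<Rightarrow> real" where
  "form f g = (\<Sum>x\<in>K. mu x * (lam x * f x - (\<Sum>y\<in>K. r x y * f y)) * g x)"

lemma form_add_left: "form (\<lambda>x. f x + f' x) g = form f g + form f' g"
proof -
  have *: "(\<Sum>y\<in>K. r x y * (f y + f' y)) = (\<Sum>y\<in>K. r x y * f y) + (\<Sum>y\<in>K. r x y * f' y)" for x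
    by (simp add: distrib_left sum.distrib)
  then show ?thesis
    unfolding form_def * by (simp add: algebra_simps sum.distrib sum_subtractf)
qed

lemma form_add_right: "form f (\<lambda>x. g x + g' x) = form f g + form f g'"
  by (simp add: form_def sum.distrib[symmetric] algebra_simps)

lemma form_scale_left: "form (\<lambda>x. a * f x) g = a * form f g"
proof -
  have "(\<Sum>y\<in>K. r x y * (a * f y)) = a * (\<Sum>y\<in>K. r x y * f y)" for x
    by (simp add: sum_distrib_left mult.left_commute)
  then show ?thesis by (simp add: form_def sum_distrib_left algebra_simps)
qed

lemma form_scale_right: "form f (\<lambda>x. a * g x) = a * form f g"
  by (simp add: form_def sum_distrib_left algebra_simps)

text \<open>The generator annihilates constants, so \<open>f\<close> may be replaced by
  \<open>f - h\<close>, which lives on \<open>K\<close>.\<close>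

lemma generator_eq:
  assumes "\<And>y. y \<notin> K \<Longrightarrow> f y = h"
  shows "generator r f x = (\<Sum>y\<in>K. r x y * (f y - h)) - lam x * (f x - h)"
proof -
  have "((\<lambda>y. r x y * (f y - h)) has_sum (\<Sum>y\<in>K. r x y * (f y - h))) UNIV"
    by (rule has_sum_finite_neutralI[OF finite_K]) (use assms in auto)
  from has_sum_minus[OF this has_sum_cmult_left[OF r_sum, of x "f x - h"]]
  show ?thesis unfolding generator_def
    by (intro infsumI) (simp add: right_diff_distrib[symmetric])
qed

text \<open>Outside \<open>K\<close> the generator of \<open>f\<close> need not vanish; stationarity makes its total
  \<open>mu\<close>-mass \<open>0\<close>, so that the constant \<open>h'\<close> drops out.\<close>

lemma inner_generator_has_sum:
  assumes f: "\<And>y. y \<notin> K \<Longrightarrow> f y = h" and g: "\<And>y. y \<notin> K \<Longrightarrow> g y = h'"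
  shows "((\<lambda>x. mu x * generator r f x * g x) has_sum - form (\<lambda>x. f x - h) (\<lambda>x. g x - h')) UNIV"
proof -
  let ?f = "\<lambda>x. f x - h"
  \<comment> \<open>Stationarity gives column \<open>y\<close> the mass \<open>mu y * lam y\<close>,
    exactly that of the diagonal term subtracted next.\<close>
  have "((\<lambda>x. \<Sum>y\<in>K. mu x * r x y * ?f y) has_sum (\<Sum>y\<in>K. mu y * lam y * ?f y)) UNIV"
    by (intro has_sum_finite_sum[OF finite_K] has_sum_cmult_left stationary)
  moreover have "((\<lambda>x. mu x * lam x * ?f x) has_sum (\<Sum>y\<in>K. mu y * lam y * ?f y)) UNIV"
    by (rule has_sum_finite_neutralI[OF finite_K]) (use f in auto)
  ultimately have "((\<lambda>x. (\<Sum>y\<in>K. mu x * r x y * ?f y) - mu x * lam x * ?f x) has_sum 0) UNIV"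
    using has_sum_minus by fastforce
  then have "((\<lambda>x. mu x * generator r f x) has_sum 0) UNIV"
    by (simp add: generator_eq[OF f] right_diff_distrib sum_distrib_left mult.assoc)
  from has_sum_cmult_left[OF this, of h']
  have 1: "((\<lambda>x. mu x * generator r f x * h') has_sum 0) UNIV" by simp
  have "((\<lambda>x. mu x * generator r f x * (g x - h')) has_sum (- form ?f (\<lambda>x. g x - h'))) UNIV"
    by (rule has_sum_finite_neutralI[OF finite_K])
      (use g in \<open>auto simp: form_def generator_eq[OF f] sum_negf[symmetric] algebra_simps\<close>)
  from has_sum_add[OF this 1] show ?thesis
    by (simp add: algebra_simps)
qed

text \<open>Expand the squares and exchange \<open>x\<close> and \<open>y\<close> in one of the
  sums. The second sum is a killing term: its coefficient is \<open>mu x\<close> times the total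
  rate out of \<open>K\<close> under \<open>r\<close> and under the adjoint rates.\<close>

lemma form_self:
  "2 * form f f = (\<Sum>x\<in>K. \<Sum>y\<in>K. mu x * r x y * (f x - f y)\<^sup>2) +
    (\<Sum>x\<in>K. (2 * (mu x * lam x) - (\<Sum>y\<in>K. mu x * r x y) - (\<Sum>y\<in>K. mu y * r y x)) * (f x)\<^sup>2)"
proof -
  have "(\<Sum>x\<in>K. \<Sum>y\<in>K. mu x * r x y * (f x - f y)\<^sup>2) =
      (\<Sum>x\<in>K. \<Sum>y\<in>K. mu x * r x y * (f x)\<^sup>2) + (\<Sum>x\<in>K. \<Sum>y\<in>K. mu x * r x y * (f y)\<^sup>2)
      - 2 * (\<Sum>x\<in>K. \<Sum>y\<in>K. mu x * r x y * f y * f x)"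
    by (simp add: power2_diff sum.distrib sum_subtractf sum_distrib_left algebra_simps)
  moreover have "(\<Sum>x\<in>K. \<Sum>y\<in>K. mu x * r x y * (f y)\<^sup>2) = (\<Sum>x\<in>K. \<Sum>y\<in>K. mu y * r y x * (f x)\<^sup>2)"
    by (rule sum.swap)
  moreover have "form f f = (\<Sum>x\<in>K. mu x * lam x * (f x)\<^sup>2) - (\<Sum>x\<in>K. \<Sum>y\<in>K. mu x * r x y * f y * f x)"
    by (simp add: form_def sum_subtractf sum_distrib_left sum_distrib_right power2_eq_square algebra_simps)
  ultimately show ?thesis
    by (simp add: left_diff_distrib sum_subtractf sum_distrib_left sum_distrib_right mult.assoc)
qed

lemma partial_sums_le:
  assumes "finite Y"
  shows "(\<Sum>y\<in>Y. mu x * r x y) \<le> mu x * lam x" "(\<Sum>y\<in>Y. mu y * r y x) \<le> mu x * lam x"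
  using finite_sum_le_has_sum[OF has_sum_cmult_right[OF r_sum, of "mu x" x] assms]
    finite_sum_le_has_sum[OF stationary assms, of x] r_nonneg mu_pos by (auto simp: less_imp_le)

lemma form_self_nonneg: "0 \<le> form f f"
proof -
  have "0 \<le> 2 * form f f"
    unfolding form_self
  proof (intro add_nonneg_nonneg sum_nonneg mult_nonneg_nonneg)
    fix x
    show "0 \<le> 2 * (mu x * lam x) - (\<Sum>y\<in>K. mu x * r x y) - (\<Sum>y\<in>K. mu y * r y x)"
      using partial_sums_le[OF finite_K, of x] by linarith
  qed (simp_all add: r_nonneg less_imp_le[OF mu_pos])
  then show ?thesis by simp
qed

text \<open>Both nonnegative sums in \<open>form_self\<close> vanish. An edge inside
  \<open>K\<close> equates its end values; an edge across the boundary of \<open>K\<close> makes the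
  killing coefficient positive at its inner end, where \<open>f\<close> is then 0 as it is
  outside.\<close>

lemma form_self_zero_edge:
  assumes zero: "form f f \<le> 0" and f: "\<And>x. x \<notin> K \<Longrightarrow> f x = 0" and edge: "0 < r x y"
  shows "f x = f y"
proof -
  define k where "k x = 2 * (mu x * lam x) - (\<Sum>y\<in>K. mu x * r x y) - (\<Sum>y\<in>K. mu y * r y x)" for x
  have k: "0 \<le> k x" for x
    using partial_sums_le[OF finite_K, of x] by (simp add: k_def)
  have c: "0 \<le> mu x * r x y" for x y using r_nonneg less_imp_le[OF mu_pos] by simp
  have nn: "0 \<le> (\<Sum>x\<in>K. \<Sum>y\<in>K. mu x * r x y * (f x - f y)\<^sup>2)" "0 \<le> (\<Sum>x\<in>K. k x * (f x)\<^sup>2)"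
    by (intro sum_nonneg mult_nonneg_nonneg[OF c] mult_nonneg_nonneg[OF k]; simp)+
  then have z: "(\<Sum>x\<in>K. \<Sum>y\<in>K. mu x * r x y * (f x - f y)\<^sup>2) = 0" "(\<Sum>x\<in>K. k x * (f x)\<^sup>2) = 0"
    using form_self[of f, folded k_def] zero by linarith+
  have kill: "f x = 0" if "x \<in> K" "0 < k x" for x
    using z(2) that k by (subst (asm) sum_nonneg_eq_0_iff[OF finite_K]) auto
  show ?thesis
  proof (cases "x \<in> K"; cases "y \<in> K")
    assume xy: "x \<in> K" "y \<in> K"
    have "(\<Sum>y\<in>K. mu x * r x y * (f x - f y)\<^sup>2) = 0"
      using z(1) xy(1) c by (subst (asm) sum_nonneg_eq_0_iff[OF finite_K]) (auto intro!: sum_nonneg)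
    then have "mu x * r x y * (f x - f y)\<^sup>2 = 0"
      using xy(2) c by (subst (asm) sum_nonneg_eq_0_iff[OF finite_K]) auto
    then show ?thesis using edge mu_pos[of x] by simp
  next
    assume xy: "x \<in> K" "y \<notin> K"
    have "0 < mu x * r x y" using edge mu_pos[of x] by simp
    \<comment> \<open>The row bound over \<open>insert y K\<close> leaves at least
      \<open>mu x * r x y\<close> in \<open>k x\<close>.\<close>
    then have "0 < k x"
      using partial_sums_le(1)[of "insert y K" x] partial_sums_le(2)[of K x] xy finite_K by (simp add: k_def)
    then show ?thesis using kill xy f by simp
  next
    assume xy: "x \<notin> K" "y \<in> K"
    have "0 < mu x * r x y" using edge mu_pos[of x] by simp
    then have "0 < k y"
      using partial_sums_le(2)[of "insert x K" y] partial_sums_le(1)[of K y] xy finite_K by (simp add: k_def)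
    then show ?thesis using kill xy f by simp
  qed (simp add: f)
qed

lemma form_self_zero:
  assumes "irreducible_rates r" "form f f \<le> 0" "\<And>x. x \<notin> K \<Longrightarrow> f x = 0" "f a = 0"
  shows "f x = 0"
proof -
  have "(a, x) \<in> {(u, v). 0 < r u v}\<^sup>*" using assms(1) by (simp add: irreducible_rates_def)
  then show ?thesis
    by (induction rule: rtrancl_induct) (use assms(4) form_self_zero_edge[OF assms(2,3)] in auto)
qed

lemma adjoint: "stationary_rates lam mu (adjoint_rate mu r) K"
proof
  fix x y
  show "0 < mu x" by (rule mu_pos)
  show "0 \<le> adjoint_rate mu r x y"
    using r_nonneg mu_pos by (simp add: adjoint_rate_def less_imp_le)
  show "(adjoint_rate mu r x has_sum lam x) UNIV"
    using has_sum_cmult_left[OF stationary, of x "1 / mu x"] mu_pos[of x]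
    unfolding adjoint_rate_def[abs_def] by (simp add: field_simps)
  show "((\<lambda>x. mu x * adjoint_rate mu r x y) has_sum (mu y * lam y)) UNIV"
    using has_sum_cmult_right[OF r_sum, of "mu y" y] mu_pos less_imp_neq[OF mu_pos]
    by (simp add: adjoint_rate_def less_imp_neq[OF mu_pos, symmetric])
qed (rule finite_K)

text \<open>As \<open>mu x\<close> times the adjoint rate from \<open>x\<close> to \<open>y\<close>
  is \<open>mu y * r y x\<close>, exchanging the summation variables transposes the form.\<close>

lemma adjoint_form: "stationary_rates.form lam mu (adjoint_rate mu r) K f g = form g f"
proof -
  have "mu x * (\<Sum>y\<in>K. adjoint_rate mu r x y * f y) * g x = (\<Sum>y\<in>K. mu y * r y x * f y * g x)" for x
    using less_imp_neq[OF mu_pos, of x]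
    by (simp add: adjoint_rate_def sum_distrib_left sum_distrib_right)
  then have "stationary_rates.form lam mu (adjoint_rate mu r) K f g =
      (\<Sum>x\<in>K. mu x * lam x * f x * g x) - (\<Sum>x\<in>K. \<Sum>y\<in>K. mu y * r y x * f y * g x)"
    by (simp add: stationary_rates.form_def[OF adjoint] right_diff_distrib left_diff_distrib
        sum_subtractf mult.assoc)
  also have "(\<Sum>x\<in>K. \<Sum>y\<in>K. mu y * r y x * f y * g x) = (\<Sum>x\<in>K. \<Sum>y\<in>K. mu x * r x y * f x * g y)"
    by (rule sum.swap)
  also have "(\<Sum>x\<in>K. mu x * lam x * f x * g x) - (\<Sum>x\<in>K. \<Sum>y\<in>K. mu x * r x y * f x * g y) = form g f"
    by (simp add: form_def sum_subtractf[symmetric] sum_distrib_left sum_distrib_right algebra_simps)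
  finally show ?thesis .
qed

text \<open>The adjoint generator acts on \<open>F\<close>, so transposition puts \<open>H\<close>
  on the left. On the diagonal the forms of both generators agree, hence so does their average. All
  series are obtained through \<open>has_sum\<close>, so no \<open>infsum\<close> takes its default
  value.\<close>

lemma saddle_functional_eq:
  assumes F: "\<And>x. x \<notin> K \<Longrightarrow> F x = 0" and H: "\<And>x. x \<notin> K \<Longrightarrow> H x = h"
  shows "saddle_functional mu r F H =
    - 2 * form (\<lambda>x. H x - h) F - form (\<lambda>x. H x - h) (\<lambda>x. H x - h)"
proof -
  interpret adj: stationary_rates lam mu "adjoint_rate mu r" K by (rule adjoint)
  let ?H = "\<lambda>x. H x - h"
  have 1: "inner_mu mu (generator (adjoint_rate mu r) F) H = - form ?H F"
    unfolding inner_mu_def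
    using adj.inner_generator_has_sum[of F 0 H h] F H by (simp add: infsumI adjoint_form)
  have "((\<lambda>x. mu x * generator r H x * H x) has_sum - form ?H ?H) UNIV"
    by (rule inner_generator_has_sum) (use H in auto)
  moreover have "((\<lambda>x. mu x * generator (adjoint_rate mu r) H x * H x) has_sum - form ?H ?H) UNIV"
    using adj.inner_generator_has_sum[of H h H h] H by (simp add: adjoint_form)
  ultimately have "((\<lambda>x. (mu x * generator r H x * H x +
      mu x * generator (adjoint_rate mu r) H x * H x) * (- 1 / 2)) has_sum
      (- form ?H ?H + - form ?H ?H) * (- 1 / 2)) UNIV"
    by (intro has_sum_cmult_left has_sum_add)
  then have "((\<lambda>x. mu x * H x * (- symmetric_generator mu r H x)) has_sum form ?H ?H) UNIV"
    by (simp add: symmetric_generator_def field_simps)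
  then have 2: "inner_mu mu H (\<lambda>x. - symmetric_generator mu r H x) = form ?H ?H"
    unfolding inner_mu_def by (rule infsumI)
  show ?thesis unfolding saddle_functional_def 1 2 by simp
qed

text \<open>Harmonicity on \<open>K - A\<close> kills every term off \<open>A\<close>, and on
  \<open>A\<close> the factor \<open>g\<close> is the constant \<open>a\<close>; the remaining sum
  is the capacity.\<close>

lemma form_equilibrium:
  assumes "A \<subseteq> K" "\<And>x. x \<in> K - A \<Longrightarrow> lam x * V x = (\<Sum>y\<in>K. r x y * V y)"
    "\<And>x. x \<in> A \<Longrightarrow> V x = 1" "\<And>x. x \<in> A \<Longrightarrow> g x = a"
  shows "form V g = a * (\<Sum>x\<in>A. mu x * (lam x - (\<Sum>y\<in>K. r x y * V y)))"
proof -
  have "form V g = (\<Sum>x\<in>A. mu x * (lam x * V x - (\<Sum>y\<in>K. r x y * V y)) * g x)"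
    unfolding form_def using assms(1,2) finite_K by (intro sum.mono_neutral_right) auto
  also have "\<dots> = (\<Sum>x\<in>A. a * (mu x * (lam x - (\<Sum>y\<in>K. r x y * V y))))"
    by (rule sum.cong) (use assms(3,4) in auto)
  finally show ?thesis by (simp add: sum_distrib_left)
qed

end

section \<open>The variational formula\<close>

theorem theorem2p4:
  fixes lam mu :: "'a :: countable \<Rightarrow> real" and p r :: "'a \<Rightarrow> 'a \<Rightarrow> real"
    and P Ps :: "'a \<Rightarrow> (real \<Rightarrow> 'a) measure" and A B :: "'a set" and FAB :: "'a \<Rightarrow> real"
  assumes "jump_parameters lam p"
    and "r = jump_rate lam p"
    and "irreducible_rates r"
    and "stationary_measure lam r mu"
    and "markov_law lam p P"
    and "markov_law lam (adjoint_prob lam mu p) Ps"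
    and "A \<inter> B = {}"
    and "finite (- B)"
    and "FAB = (\<lambda>x. (equilibrium_potential P A B x + equilibrium_potential Ps A B x) / 2)"
  shows "ereal (capacity lam mu P A B) = (INF F\<in>boundary_functions A B. sup_functional mu r A B F) \<and>
    FAB \<in> boundary_functions A B \<and>
    sup_functional mu r A B FAB = (INF F\<in>boundary_functions A B. sup_functional mu r A B F) \<and>
    (A \<union> B \<noteq> {} \<longrightarrow>
      (\<forall>F\<in>boundary_functions A B.
         sup_functional mu r A B F = (INF G\<in>boundary_functions A B. sup_functional mu r A B G)
         \<longrightarrow> F = FAB))"
proof -
  define K where "K = - B"
  define V where "V = equilibrium_potential P A B"
  define W where "W = equilibrium_potential Ps A B"
  define cap where "cap = capacity lam mu P A B"
  have irr: "irreducible_rates (jump_rate lam p)" using assms(2,3) by simp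
  have st: "stationary_measure lam (jump_rate lam p) mu" using assms(2,4) by simp
  have mu_pos: "0 < mu x" for x using assms(4) by (simp add: stationary_measure_def)
  note jps = jump_parameters_adjoint[OF assms(1) st]
  have rs: "jump_rate lam (adjoint_prob lam mu p) = adjoint_rate mu r"
    using jump_rate_adjoint_prob[OF assms(1) st] assms(2) by simp
  have irrs: "irreducible_rates (jump_rate lam (adjoint_prob lam mu p))"
    unfolding rs by (rule irreducible_adjoint_rate[OF assms(3) mu_pos])
  interpret stationary_rates lam mu r K
  proof
    fix x y
    show "0 \<le> r x y" using jump_parametersD(1,2)[OF assms(1)] by (simp add: assms(2) jump_rate_def)
    show "(r x has_sum lam x) UNIV"
      using has_sum_cmult_right[OF jump_parametersD(4)[OF assms(1)], of "lam x" x]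
      unfolding assms(2) jump_rate_def[abs_def] by (auto split: if_splits)
    show "((\<lambda>x. mu x * r x y) has_sum (mu y * lam y)) UNIV"
      using assms(4) by (simp add: stationary_measure_def)
    show "finite K" using assms(8) by (simp add: K_def)
  qed (rule mu_pos)
  interpret adj: stationary_rates lam mu "adjoint_rate mu r" K by (rule adjoint)
  have AK: "A \<subseteq> K" using assms(7) by (auto simp: K_def)
  note VA = equilibrium_potential_boundary(1)[OF assms(1) irr assms(5,7,8), folded V_def]
  note VB = equilibrium_potential_boundary(2)[OF assms(1) irr assms(5,7,8), folded V_def]
  note WA = equilibrium_potential_boundary(1)[OF jps irrs assms(6,7,8), folded W_def]
  note WB = equilibrium_potential_boundary(2)[OF jps irrs assms(6,7,8), folded W_def]
  have V_harm: "lam x * V x = (\<Sum>y\<in>K. r x y * V y)" if "x \<in> K - A" for x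
    using equilibrium_potential_harmonic[OF assms(1) irr assms(5,7,8), of x] that
    by (auto simp: V_def K_def assms(2))
  have W_harm: "lam x * W x = (\<Sum>y\<in>K. adjoint_rate mu r x y * W y)" if "x \<in> K - A" for x
    using equilibrium_potential_harmonic[OF jps irrs assms(6,7,8), of x] that
    by (auto simp: W_def K_def rs)
  have cap: "cap = (\<Sum>x\<in>A. mu x * (lam x - (\<Sum>y\<in>K. r x y * V y)))"
    using capacity_eq_sum[OF assms(1) irr assms(5,7,8), of mu] by (simp add: cap_def V_def K_def assms(2))
  have formV: "form V g = a * cap" if "\<And>x. x \<in> A \<Longrightarrow> g x = a" for g a
    unfolding cap by (rule form_equilibrium[OF AK V_harm VA that])
  have formW: "form g W = a * cap" if "\<And>x. x \<in> A \<Longrightarrow> g x = a" for g a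
  proof -
    let ?c = "\<Sum>x\<in>A. mu x * (lam x - (\<Sum>y\<in>K. adjoint_rate mu r x y * W y))"
    have *: "form g W = a * ?c" if "\<And>x. x \<in> A \<Longrightarrow> g x = a" for g a
      using adj.form_equilibrium[OF AK W_harm WA that] by (simp add: adjoint_form)
    \<comment> \<open>The process and its adjoint have the same capacity: both numbers equal
      \<open>form V W\<close>, because \<open>V\<close> and \<open>W\<close> are 1 on
      \<open>A\<close>.\<close>
    have "?c = cap" using *[of V 1, OF VA] formV[of W 1, OF WA] by simp
    then show ?thesis using *[OF that] by simp
  qed
  have FAB: "FAB = (\<lambda>x. (1/2) * V x + (1/2) * W x)"
    using assms(9) by (simp add: V_def W_def add_divide_distrib)
  have FAB_bd: "FAB \<in> boundary_functions A B"
    using VA VB WA WB by (auto simp: FAB boundary_functions_def)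
  \<comment> \<open>Completing the square: \<open>form H W = a * cap = form V H\<close>, so
    \<open>2 * form H FAB\<close> is \<open>form H V + form V H\<close>, and
    \<open>form V V = cap\<close> supplies the missing square.\<close>
  have saddle_FAB: "- 2 * form H FAB - form H H = cap - form (\<lambda>x. H x + V x) (\<lambda>x. H x + V x)"
    if "\<And>x. x \<in> A \<Longrightarrow> H x = a" for H a
  proof -
    have "form H FAB = (1/2) * form H V + (1/2) * form H W"
      unfolding FAB form_add_right form_scale_right ..
    then show ?thesis
      using formW[of H a] formV[of H a] formV[of V 1] VA that
      by (simp add: form_add_left form_add_right)
  qed
  have testD: thesis if H: "H \<in> test_functions A B"
      and "\<And>h a. (\<And>x. x \<notin> K \<Longrightarrow> H x = h) \<Longrightarrow> (\<And>x. x \<in> A \<Longrightarrow> H x - h = a) \<Longrightarrow> thesis" for H thesis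
  proof -
    obtain h a where "\<forall>x\<in>B. H x = h" "\<forall>x\<in>A. H x = a"
      using H by (auto simp: test_functions_def constant_on_def)
    then show thesis using that(2)[of h "a - h"] by (auto simp: K_def)
  qed
  have bdD: "F x = 0" if "F \<in> boundary_functions A B" "x \<notin> K" for F x
    using that by (auto simp: boundary_functions_def K_def)
  have upper: "sup_functional mu r A B FAB \<le> ereal cap"
    unfolding sup_functional_def
  proof (rule SUP_least)
    fix H assume "H \<in> test_functions A B"
    then obtain h a where h: "\<And>x. x \<notin> K \<Longrightarrow> H x = h" "\<And>x. x \<in> A \<Longrightarrow> H x - h = a"
      using testD by metis
    have "saddle_functional mu r FAB H = cap - form (\<lambda>x. (H x - h) + V x) (\<lambda>x. (H x - h) + V x)"
      using saddle_functional_eq[OF bdD[OF FAB_bd] h(1)] saddle_FAB[of "\<lambda>x. H x - h" a] h(2) by simp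
    then show "ereal (saddle_functional mu r FAB H) \<le> ereal cap"
      using form_self_nonneg by simp
  qed
  have saddle_test: "ereal (- 2 * form H F - form H H) \<le> sup_functional mu r A B F"
    if F: "F \<in> boundary_functions A B" and H: "\<And>x. x \<notin> K \<Longrightarrow> H x = 0" "\<And>x. x \<in> A \<Longrightarrow> H x = a" for F H a
  proof -
    have "H \<in> test_functions A B"
      using H by (auto simp: test_functions_def constant_on_def K_def)
    moreover have "saddle_functional mu r F H = - 2 * form H F - form H H"
      using saddle_functional_eq[OF bdD[OF F] H(1)] by simp
    ultimately show ?thesis
      unfolding sup_functional_def by (metis SUP_upper)
  qed
  have VK: "V x = 0" if "x \<notin> K" for x using VB that by (simp add: K_def)
  have lower: "ereal cap \<le> sup_functional mu r A B F" if F: "F \<in> boundary_functions A B" for F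
  proof -
    have "form V F = cap" "form V V = cap"
      using formV[of F 1] formV[of V 1] VA F by (auto simp: boundary_functions_def)
    \<comment> \<open>The value is \<open>2 * cap - cap\<close>, since \<open>F\<close> and
      \<open>V\<close> are both 1 on \<open>A\<close>.\<close>
    then have "- 2 * form (\<lambda>x. (-1) * V x) F - form (\<lambda>x. (-1) * V x) (\<lambda>x. (-1) * V x) = cap"
      unfolding form_scale_left form_scale_right by simp
    then show ?thesis
      using saddle_test[OF F, of "\<lambda>x. (-1) * V x" "-1"] VA VK by simp
  qed
  have FAB_sup: "sup_functional mu r A B FAB = ereal cap"
    using upper lower[OF FAB_bd] by (rule antisym)
  have INF: "(INF F\<in>boundary_functions A B. sup_functional mu r A B F) = ereal cap"
    using lower FAB_sup FAB_bd by (intro antisym INF_greatest) (metis INF_lower)+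
  have unique: "F = FAB" if ne: "A \<union> B \<noteq> {}" and F: "F \<in> boundary_functions A B"
    and opt: "sup_functional mu r A B F = ereal cap" for F
  proof -
    define G where "G x = F x - FAB x" for x
    \<comment> \<open>Here \<open>H + V = - G\<close>, and \<open>form V G = 0\<close> as
      \<open>G\<close> vanishes on \<open>A\<close>. The functional at \<open>F\<close> and
      \<open>H\<close> is therefore \<open>cap - form G G + 2 * form G G\<close>, and optimality of
      \<open>F\<close> bounds it by \<open>cap\<close>.\<close>
    define H where "H x = (-1) * G x + (-1) * V x" for x
    have G0: "G x = 0" if "x \<in> A \<union> B" for x
      using F FAB_bd that by (auto simp: G_def boundary_functions_def)
    have HA: "H x = -1" if "x \<in> A" for x using that G0 VA by (simp add: H_def)
    have HK: "H x = 0" if "x \<notin> K" for x using that G0 VK by (simp add: H_def K_def)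
    have "- 2 * form H F - form H H \<le> cap"
      using saddle_test[OF F HK HA] opt by simp
    moreover have "form H F = form H FAB + form H G"
      using form_add_right[of H FAB G] by (simp add: G_def)
    moreover have "form H G = - form G G"
      using formV[of G 0] G0 unfolding H_def form_add_left form_scale_left by simp
    moreover have "form (\<lambda>x. H x + V x) (\<lambda>x. H x + V x) = form G G"
      using form_scale_left[of "-1" G "\<lambda>x. (-1) * G x"] form_scale_right[of G "-1" G]
      by (simp add: H_def)
    ultimately have "form G G \<le> 0"
      using saddle_FAB[of H "-1"] HA by simp
    \<comment> \<open>Vanishing of the form only makes \<open>G\<close> constant along edges; a
      point of \<open>A \<union> B\<close> fixes that constant at 0.\<close>
    moreover obtain a where "a \<in> A \<union> B" using ne by blast
    ultimately have "G x = 0" for x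
      using form_self_zero[OF assms(3), of G a x] G0 by (auto simp: K_def)
    then show ?thesis by (auto simp: G_def)
  qed
  show ?thesis
    unfolding INF using FAB_bd FAB_sup unique by (simp add: cap_def)
qed

end
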